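(* Let $\mu$ be a Borel probability measure on $\mathbb{C}$ with compact support. If there exists $c\in\mathbb{C}$ with $\operatorname{supp}\mu\subset\overline{B}(c,r_{\mathrm{bif}}(c))$, then the polynomial semigroup $G_\mu$ has a planar minimal set. If there exists $c\in\mathbb{C}$ with $\operatorname{int}(\operatorname{supp}\mu)\supset\overline{B}(c,r_{\mathrm{bif}}(c))$, then the random Julia set $J_\omega$ is totally disconnected for $\mathbb{P}_\mu$-almost every $\omega\in\Omega_\mu$.
   Context: $f_c(z)=z^2+c$, extended to $\widehat{\mathbb{C}}$ by $f_c(\infty)=\infty$; $\overline{B}(c,r)=\{c'\in\mathbb{C}:|c'-c|\le r\}$. $G_\mu$ is the semigroup under composition generated by $\{f_{c'}:c'\in\operatorname{supp}\mu\}$, and $G_{c,r}$ the one generated by $\{f_{c'}:c'\in\overline{B}(c,r)\}$. $\mathbb{P}_\mu$ is the infinite product of $\mu$ on $\Omega_\mu=\prod_{n\ge1}\operatorname{supp}\mu$. For $\omega=(c_n)$, $f^{(n)}_\omega=f_{c_n}\circ\cdots\circ f_{c_1}$ and $J_\omega=\{z\in\mathbb{C}:\{f^{(n)}_\omega\}_n$ is not normal on any neighborhood of $z\}$. A minimal set of a polynomial semigroup $G$ is a minimal element, with respect to inclusion, of the family of non-empty compact $L\subset\widehat{\mathbb{C}}$ with $g(L)\subset L$ for all $g\in G$; it is planar if $\infty\notin L$. The bifurcation radius $r_{\mathrm{bif}}(c)$ is the supremum of those $r\ge0$ for which $G_{c,r}$ has a planar minimal set (equivalently the infimum of those $r\ge0$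 for which $G_{c,r}$ has no planar minimal set); by prior work this value is attained and $G_{c,r}$ has a planar minimal set iff $r\le r_{\mathrm{bif}}(c)$. *)

theory Defs
  imports "HOL-Analysis.Analysis" "HOL-Probability.Probability"
begin

definition fq :: "complex \<Rightarrow> complex \<Rightarrow> complex" where
  "fq c = (\<lambda>z. z ^ 2 + c)"

inductive_set poly_semigroup :: "complex set \<Rightarrow> (complex \<Rightarrow> complex) set"
  for S :: "complex set" where
  gen: "c \<in> S \<Longrightarrow> fq c \<in> poly_semigroup S"
| comp: "g \<in> poly_semigroup S \<Longrightarrow> h \<in> poly_semigroup S \<Longrightarrow> g \<circ> h \<in> poly_semigroup S"

definition forward_invariant :: "(complex \<Rightarrow> complex) set \<Rightarrow> complex set \<Rightarrow> bool" where
  "forward_invariant G L \<longleftrightarrow> (\<forall>g\<in>G. g ` L \<subseteq> L)"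

text \<open>A planar minimal set: a minimal non-empty compact forward invariant subset of the
  Riemann sphere not containing infinity. Since it lies in the plane, all its compact
  subsets lie in the plane, so minimality may be tested against compact subsets of the plane.\<close>
definition planar_minimal_set :: "(complex \<Rightarrow> complex) set \<Rightarrow> complex set \<Rightarrow> bool" where
  "planar_minimal_set G L \<longleftrightarrow>
     L \<noteq> {} \<and> compact L \<and> forward_invariant G L \<and>
     (\<forall>K. K \<subseteq> L \<and> K \<noteq> {} \<and> compact K \<and> forward_invariant G K \<longrightarrow> K = L)"

definition has_planar_minimal_set :: "(complex \<Rightarrow> complex) set \<Rightarrow> bool" where
  "has_planar_minimal_set G \<longleftrightarrow> (\<exists>L. planar_minimal_set G L)"

definition r_bif :: "complex \<Rightarrow> real" where
  "r_bif c = Sup {r. r \<ge> 0 \<and> has_planar_minimal_set (poly_semigroup (cball c r))}"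

definition msupp :: "complex measure \<Rightarrow> complex set" where
  "msupp \<mu> = {z. \<forall>e>0. emeasure \<mu> (ball z e) > 0}"

text \<open>Chordal (spherical) metric on the Riemann sphere, modelled as complex option
  with None = infinity.\<close>
fun chordal :: "complex option \<Rightarrow> complex option \<Rightarrow> real" where
  "chordal (Some z) (Some w) =
     2 * cmod (z - w) / sqrt ((1 + (cmod z)\<^sup>2) * (1 + (cmod w)\<^sup>2))"
| "chordal (Some z) None = 2 / sqrt (1 + (cmod z)\<^sup>2)"
| "chordal None (Some w) = 2 / sqrt (1 + (cmod w)\<^sup>2)"
| "chordal None None = 0"

definition normal_family :: "(complex \<Rightarrow> complex) set \<Rightarrow> complex set \<Rightarrow> bool" where
  "normal_family F U \<longleftrightarrow>
    (\<forall>s :: nat \<Rightarrow> complex \<Rightarrow> complex. (\<forall>k. s k \<in> F) \<longrightarrow>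
      (\<exists>r g. strict_mono r \<and>
         (\<forall>K. compact K \<and> K \<subseteq> U \<longrightarrow>
            (\<forall>e>0. eventually (\<lambda>j. \<forall>z\<in>K. chordal (Some (s (r j) z)) (g z) < e) sequentially))))"

text \<open>Iterates along omega = (c_1, c_2, ...), indexed from 0:
  iter_seq omega n = f_{omega (n-1)} o ... o f_{omega 0}.\<close>
primrec iter_seq :: "(nat \<Rightarrow> complex) \<Rightarrow> nat \<Rightarrow> complex \<Rightarrow> complex" where
  "iter_seq \<omega> 0 = id"
| "iter_seq \<omega> (Suc n) = fq (\<omega> n) \<circ> iter_seq \<omega> n"

definition random_julia :: "(nat \<Rightarrow> complex) \<Rightarrow> complex set" where
  "random_julia \<omega> = {z. \<forall>U. open U \<and> z \<in> U \<longrightarrow>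
       \<not> normal_family {iter_seq \<omega> n | n. n \<ge> 1} U}"

definition totally_disconnected :: "'a::topological_space set \<Rightarrow> bool" where
  "totally_disconnected S \<longleftrightarrow> (\<forall>C. C \<subseteq> S \<and> connected C \<longrightarrow> (\<exists>a. C \<subseteq> {a}))"

end

theory Submission
  imports Defs "HOL-Complex_Analysis.Complex_Analysis"
begin

text \<open>
  A planar minimal set exists as soon as some nonempty compact set is invariant under the
  generators. Such sets lie in a fixed disc, so a limit of invariant sets for the radii below
  \<open>r_bif c\<close> is invariant for the radius \<open>r_bif c\<close> itself; this gives the first claim.

  In the second claim the support contains a disc about \<open>c\<close> of radius larger than \<open>r_bif c\<close>, so
  every point is driven to infinity by some word in the support. By compactness the probability
  that an orbit stays bounded up to time \<open>n\<close> decays geometrically, uniformly in the starting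
  point. Hence almost surely (i) every point of a countable dense set escapes, and (ii) for some
  \<open>N\<close> there are infinitely many times \<open>n = m + N\<close> at which every critical point born before time
  \<open>m\<close> has escaped. Let \<open>C\<close> be a connected set of points with bounded orbits. By (ii) the
  iterate \<open>f\<^sup>m\<close> has an inverse branch, defined on a component \<open>W\<close> of the preimage of a disc under
  the following \<open>N\<close> steps, that sends \<open>f\<^sup>m(C)\<close> back to \<open>C\<close>; here \<open>W\<close> is simply connected by the
  maximum principle. Along a subsequence the \<open>N\<close>-step blocks converge, so \<open>W\<close> can be fixed, and
  by Montel the branches converge. A nonconstant limit would have an open image consisting of
  bounded orbits, against (i). So the limit is constant and \<open>C\<close> is a point.
\<close>

section \<open>Nonautonomous quadratic iteration\<close>

lemma iter_seq_add:
  "iter_seq \<omega> (k + n) z = iter_seq (\<lambda>i. \<omega> (k + i)) n (iter_seq \<omega> k z)"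
  by (induction n) auto

lemma iter_seq_cong:
  "(\<And>i. i < n \<Longrightarrow> \<omega> i = \<omega>' i) \<Longrightarrow> iter_seq \<omega> n z = iter_seq \<omega>' n z"
  by (induction n) auto

lemma iter_seq_case_nat:
  "iter_seq (case_nat c \<omega>) (Suc n) z = iter_seq \<omega> n (fq c z)"
  using iter_seq_add[of "case_nat c \<omega>" 1 n z] by simp

lemma holomorphic_iter_seq [holomorphic_intros]: "iter_seq \<omega> n holomorphic_on A"
proof (induction n)
  case (Suc n)
  then show ?case by (auto simp: fq_def o_def intro!: holomorphic_intros)
qed (auto simp: id_def)

lemma continuous_on_iter_seq: "continuous_on A (iter_seq \<omega> n)"
  using holomorphic_iter_seq holomorphic_on_imp_continuous_on by blast

lemma tendsto_iter_seq:
  assumes "\<And>i. i < n \<Longrightarrow> ((\<lambda>j. \<omega> j i) \<longlongrightarrow> \<omega>' i) F" and "(z \<longlongrightarrow> z') F"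
  shows "((\<lambda>j. iter_seq (\<omega> j) n (z j)) \<longlongrightarrow> iter_seq \<omega>' n z') F"
  using assms
proof (induction n)
  case (Suc n)
  then show ?case by (auto simp: fq_def intro!: tendsto_intros)
qed auto

text \<open>Squaring gains a factor of at least \<open>\<rho> + 2\<close>; of this,
  \<open>\<rho> * cmod z\<close> pays for the added constant, as \<open>cmod z \<ge> 1\<close>. So
  \<open>\<rho> + 2\<close> is an escape radius common to all parameters of modulus at most
  \<rho>.\<close>

lemma cmod_fq_ge:
  assumes "cmod c \<le> \<rho>" "\<rho> + 2 \<le> cmod z"
  shows "2 * cmod z \<le> cmod (fq c z)"
proof -
  have "\<rho> \<ge> 0" using assms(1) norm_ge_zero order_trans by blast
  have "(\<rho> + 2) * cmod z \<le> cmod z * cmod z"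
    using assms(2) by (intro mult_right_mono) auto
  moreover have "\<rho> * 1 \<le> \<rho> * cmod z"
    using assms \<open>\<rho> \<ge> 0\<close> by (intro mult_left_mono) auto
  moreover have "cmod (z ^ 2) - cmod c \<le> cmod (fq c z)"
    unfolding fq_def using norm_diff_ineq by blast
  ultimately show ?thesis
    using assms(1) by (simp add: norm_mult power2_eq_square algebra_simps)
qed

lemma cmod_iter_seq_ge:
  assumes "\<And>i. i < n \<Longrightarrow> cmod (\<omega> i) \<le> \<rho>" "\<rho> + 2 \<le> cmod z"
  shows "2 ^ n * cmod z \<le> cmod (iter_seq \<omega> n z)"
  using assms(1)
proof (induction n)
  case (Suc n)
  then have "2 ^ n * cmod z \<le> cmod (iter_seq \<omega> n z)" by simp
  moreover have "1 * cmod z \<le> 2 ^ n * cmod z" by (intro mult_right_mono) auto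
  ultimately show ?case
    using cmod_fq_ge[OF Suc.prems[of n], of "iter_seq \<omega> n z"] assms(2) by simp
qed auto

lemma cmod_iter_seq_ge_self:
  assumes "\<And>i. i < n \<Longrightarrow> cmod (\<omega> i) \<le> \<rho>" "\<rho> + 2 \<le> cmod z"
  shows "cmod z \<le> cmod (iter_seq \<omega> n z)"
proof -
  have "1 * cmod z \<le> 2 ^ n * cmod z" by (intro mult_right_mono) auto
  then show ?thesis using cmod_iter_seq_ge[of n \<omega> \<rho> z, OF assms] by simp
qed

lemma cmod_iter_seq_escaped:
  assumes "\<And>i. cmod (\<omega> i) \<le> \<rho>" "\<rho> + 2 \<le> b" "b < cmod (iter_seq \<omega> n z)" "n \<le> m"
  shows "b < cmod (iter_seq \<omega> m z)"
  using cmod_iter_seq_ge_self[of "m - n" "\<lambda>i. \<omega> (n + i)" \<rho> "iter_seq \<omega> n z"]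
    iter_seq_add[of \<omega> n "m - n" z] assms by auto

section \<open>The bifurcation radius\<close>

lemma forward_invariant_poly_semigroup_iff:
  "forward_invariant (poly_semigroup S) L \<longleftrightarrow> (\<forall>c\<in>S. fq c ` L \<subseteq> L)"
proof
  assume L: "\<forall>c\<in>S. fq c ` L \<subseteq> L"
  have "g ` L \<subseteq> L" if "g \<in> poly_semigroup S" for g
    using that by induction (use L in auto)
  then show "forward_invariant (poly_semigroup S) L"
    by (auto simp: forward_invariant_def)
qed (auto simp: forward_invariant_def intro: poly_semigroup.gen)

lemma iter_seq_mem_invariant:
  assumes "\<forall>c\<in>S. fq c ` L \<subseteq> L" "\<And>i. i < n \<Longrightarrow> \<omega> i \<in> S" "z \<in> L"
  shows "iter_seq \<omega> n z \<in> L"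
  using assms(2)
proof (induction n)
  case (Suc n)
  then have "iter_seq \<omega> n z \<in> L" "\<omega> n \<in> S" by auto
  then show ?case using assms(1) by auto
qed (use assms in auto)

text \<open>Zorn's lemma for reverse inclusion: a nonempty chain of nonempty compact invariant sets
  has an intersection of the same kind. Exhibiting any one such set is then enough.\<close>

lemma has_planar_minimal_set_iff:
  "has_planar_minimal_set (poly_semigroup S) \<longleftrightarrow>
     (\<exists>L. L \<noteq> {} \<and> compact L \<and> (\<forall>c\<in>S. fq c ` L \<subseteq> L))"
proof
  assume "\<exists>L. L \<noteq> {} \<and> compact L \<and> (\<forall>c\<in>S. fq c ` L \<subseteq> L)"
  then obtain L where L: "L \<noteq> {}" "compact L" "\<forall>c\<in>S. fq c ` L \<subseteq> L" by blast
  define \<A> where "\<A> = {K. K \<subseteq> L \<and> K \<noteq> {} \<and> compact K \<and> (\<forall>c\<in>S. fq c ` K \<subseteq> K)}"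
  have "\<exists>m\<in>\<A>. \<forall>a\<in>\<A>. m \<supseteq> a \<longrightarrow> a = m"
  proof (rule predicate_Zorn)
    show "partial_order_on \<A> (relation_of (\<lambda>x y. y \<subseteq> x) \<A>)"
      by (auto simp: partial_order_on_def preorder_on_def refl_on_def trans_def antisym_def
          relation_of_def)
    fix \<C> assume "\<C> \<in> Chains (relation_of (\<lambda>x y. y \<subseteq> x) \<A>)"
    then have chain: "\<And>A B. A \<in> \<C> \<Longrightarrow> B \<in> \<C> \<Longrightarrow> A \<subseteq> B \<or> B \<subseteq> A" and sub: "\<C> \<subseteq> \<A>"
      by (auto simp: Chains_def relation_of_def)
    show "\<exists>u\<in>\<A>. \<forall>a\<in>\<C>. u \<subseteq> a"
    proof (cases "\<C> = {}")
      case True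
      then show ?thesis using L by (auto simp: \<A>_def)
    next
      case False
      have "\<Inter>\<C> \<noteq> {}"
        using sub chain by (intro compact_chain) (auto simp: \<A>_def)
      moreover have "compact (\<Inter>\<C>)"
        using sub False by (intro compact_Inter) (auto simp: \<A>_def)
      moreover have "\<forall>c\<in>S. fq c ` \<Inter>\<C> \<subseteq> \<Inter>\<C>"
        using sub by (fastforce simp: \<A>_def)
      moreover have "\<Inter>\<C> \<subseteq> L"
        using sub False unfolding \<A>_def by blast
      ultimately have "\<Inter>\<C> \<in> \<A>" unfolding \<A>_def by blast
      then show ?thesis by blast
    qed
  qed
  then obtain m where "m \<in> \<A>" "\<forall>a\<in>\<A>. a \<subseteq> m \<longrightarrow> a = m" by blast
  then have "planar_minimal_set (poly_semigroup S) m"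
    unfolding planar_minimal_set_def forward_invariant_poly_semigroup_iff \<A>_def
    by (intro conjI allI impI) (simp_all, meson order_trans)
  then show "has_planar_minimal_set (poly_semigroup S)"
    unfolding has_planar_minimal_set_def by blast
next
  assume "has_planar_minimal_set (poly_semigroup S)"
  then obtain L where "planar_minimal_set (poly_semigroup S) L"
    unfolding has_planar_minimal_set_def by blast
  then show "\<exists>L. L \<noteq> {} \<and> compact L \<and> (\<forall>c\<in>S. fq c ` L \<subseteq> L)"
    unfolding planar_minimal_set_def forward_invariant_poly_semigroup_iff
    by (intro exI[of _ L]) simp
qed

lemma has_planar_minimal_set_mono:
  assumes "has_planar_minimal_set (poly_semigroup T)" "S \<subseteq> T"
  shows "has_planar_minimal_set (poly_semigroup S)"
proof -
  obtain L where "L \<noteq> {}" "compact L" "\<forall>c\<in>T. fq c ` L \<subseteq> L"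
    using assms(1) unfolding has_planar_minimal_set_iff by blast
  then show ?thesis
    unfolding has_planar_minimal_set_iff using assms(2) by (intro exI[of _ L]) auto
qed

text \<open>The largest subset of the closed disc of radius \<open>M\<close> that is mapped into
  itself by \<open>fq c\<close> for all \<open>c \<in> S\<close>. If it is empty, every point is
  driven beyond \<open>M\<close> by some finite word over \<open>S\<close>.\<close>

definition invariant_core :: "complex set \<Rightarrow> real \<Rightarrow> complex set" where
  "invariant_core S M = {z. \<forall>\<omega> n. (\<forall>i<n. \<omega> i \<in> S) \<longrightarrow> cmod (iter_seq \<omega> n z) \<le> M}"

lemma invariant_core_subset_cball: "invariant_core S M \<subseteq> cball 0 M"
proof
  fix z assume "z \<in> invariant_core S M"
  then have "cmod (iter_seq (\<lambda>_. 0) 0 z) \<le> M"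
    unfolding invariant_core_def by blast
  then show "z \<in> cball 0 M" by simp
qed

lemma compact_invariant_core: "compact (invariant_core S M)"
proof -
  have "invariant_core S M =
      (\<Inter>(\<omega>, n)\<in>{(\<omega>, n). \<forall>i<n. \<omega> i \<in> S}. {z. cmod (iter_seq \<omega> n z) \<le> M})"
    unfolding invariant_core_def by auto
  moreover have "closed {z. cmod (iter_seq \<omega> n z) \<le> M}" for \<omega> n
    by (intro closed_Collect_le continuous_intros continuous_on_iter_seq)
  ultimately have "closed (invariant_core S M)" by (auto intro!: closed_INT)
  then show ?thesis
    using invariant_core_subset_cball bounded_cball bounded_subset compact_eq_bounded_closed
    by metis
qed

text \<open>A word applied to \<open>fq c z\<close> is the word with \<open>c\<close> prepended,
  applied to \<open>z\<close>.\<close>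

lemma fq_image_invariant_core:
  assumes "c \<in> S"
  shows "fq c ` invariant_core S M \<subseteq> invariant_core S M"
proof (clarsimp simp: invariant_core_def)
  fix z \<omega> and n :: nat
  assume *: "\<forall>\<omega> n. (\<forall>i<n. \<omega> i \<in> S) \<longrightarrow> cmod (iter_seq \<omega> n z) \<le> M" and \<omega>: "\<forall>i<n. \<omega> i \<in> S"
  have "\<forall>i<Suc n. case_nat c \<omega> i \<in> S"
    using assms \<omega> by (auto split: nat.split)
  with * have "cmod (iter_seq (case_nat c \<omega>) (Suc n) z) \<le> M" by blast
  then show "cmod (iter_seq \<omega> n (fq c z)) \<le> M" by (simp only: iter_seq_case_nat)
qed

lemma has_planar_minimal_set_if_invariant_core:
  "invariant_core S M \<noteq> {} \<Longrightarrow> has_planar_minimal_set (poly_semigroup S)"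
  unfolding has_planar_minimal_set_iff
  by (intro exI[of _ "invariant_core S M"] conjI compact_invariant_core ballI
      fq_image_invariant_core)

text \<open>Beyond the escape radius, iterating \<open>fq c\<close> alone makes orbits grow
  geometrically, which boundedness of \<open>L\<close> forbids. The bound involves one parameter
  only, so invariant sets for all balls centred at \<open>c\<close> share a disc.\<close>

lemma compact_invariant_subset_cball:
  assumes "compact L" "fq c ` L \<subseteq> L"
  shows "L \<subseteq> cball 0 (cmod c + 2)"
proof
  fix z assume z: "z \<in> L"
  obtain B where B: "\<And>w. w \<in> L \<Longrightarrow> cmod w \<le> B"
    using assms(1) compact_imp_bounded bounded_iff by metis
  show "z \<in> cball 0 (cmod c + 2)"
  proof (rule ccontr)
    assume "z \<notin> cball 0 (cmod c + 2)"
    then have z1: "cmod c + 2 < cmod z" by simp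
    obtain n where n: "B < 2 ^ n" using real_arch_pow[of 2 B] by auto
    have "2 ^ n * 1 \<le> 2 ^ n * cmod z"
      using z1 norm_ge_zero[of c] by (intro mult_left_mono) (linarith, simp)
    also have "\<dots> \<le> cmod (iter_seq (\<lambda>_. c) n z)"
      using z1 by (intro cmod_iter_seq_ge[where \<rho> = "cmod c"]) auto
    also have "\<dots> \<le> B"
      by (intro B iter_seq_mem_invariant[of "{c}"]) (use assms z in auto)
    finally show False using n by simp
  qed
qed

section \<open>The supremum that defines the bifurcation radius\<close>

lemma has_planar_minimal_set_cball_0:
  "has_planar_minimal_set (poly_semigroup (cball c 0))"
proof -
  \<comment> \<open>The quadratic formula yields a fixed point of \<open>fq c\<close>, an invariant
    compact set by itself.\<close>
  define q where "q = csqrt (1 - 4 * c)"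
  define z where "z = (1 + q) / 2"
  have "fq c z = z"
  proof -
    have "q * q = 1 - 4 * c"
      using power2_csqrt[of "1 - 4 * c"] by (simp add: q_def power2_eq_square)
    moreover have "fq c z - z = (q * q - (1 - 4 * c)) / 4"
      by (simp add: fq_def z_def power2_eq_square field_simps)
    ultimately show ?thesis by simp
  qed
  then show ?thesis
    unfolding has_planar_minimal_set_iff by (intro exI[of _ "{z}"]) auto
qed

text \<open>If \<open>z\<close> lies in an invariant set, so does
  \<open>fq (c + of_real r) z\<close>. Both lie in the disc of radius \<open>cmod c + 2\<close>,
  which bounds \<open>r\<close>.\<close>

lemma bdd_above_planar_radii:
  "bdd_above {r. r \<ge> 0 \<and> has_planar_minimal_set (poly_semigroup (cball c r))}"
proof (rule bdd_aboveI, clarify)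
  fix r :: real
  assume r: "0 \<le> r" "has_planar_minimal_set (poly_semigroup (cball c r))"
  then obtain L z where L: "compact L" "\<forall>c'\<in>cball c r. fq c' ` L \<subseteq> L" "z \<in> L"
    unfolding has_planar_minimal_set_iff by blast
  have "L \<subseteq> cball 0 (cmod c + 2)"
    using L r by (intro compact_invariant_subset_cball) auto
  moreover have "fq (c + of_real r) z \<in> L"
  proof -
    have "c + of_real r \<in> cball c r" using r by (simp add: dist_norm)
    then show ?thesis using L by blast
  qed
  ultimately have z: "cmod z \<le> cmod c + 2" "cmod (z ^ 2 + (c + of_real r)) \<le> cmod c + 2"
    using L(3) by (auto simp: fq_def)
  have "cmod (of_real r) = cmod (z ^ 2 + (c + of_real r) - z ^ 2 - c)" by simp
  also have "\<dots> \<le> cmod (z ^ 2 + (c + of_real r)) + cmod (z ^ 2) + cmod c"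
    using norm_triangle_ineq4[of "z ^ 2 + (c + of_real r) - z ^ 2" c]
      norm_triangle_ineq4[of "z ^ 2 + (c + of_real r)" "z ^ 2"] by linarith
  finally have "r \<le> cmod (z ^ 2 + (c + of_real r)) + cmod (z ^ 2) + cmod c"
    using r by simp
  moreover have "cmod (z ^ 2) \<le> (cmod c + 2) ^ 2"
    using z by (simp add: norm_power power_mono)
  ultimately show "r \<le> (cmod c + 2) + (cmod c + 2) ^ 2 + cmod c"
    using z r by simp
qed

lemma r_bif_nonneg: "0 \<le> r_bif c"
  unfolding r_bif_def
  by (intro cSup_upper bdd_above_planar_radii CollectI conjI order_refl
      has_planar_minimal_set_cball_0)

lemma le_r_bif:
  "0 \<le> r \<Longrightarrow> has_planar_minimal_set (poly_semigroup (cball c r)) \<Longrightarrow> r \<le> r_bif c"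
  unfolding r_bif_def by (intro cSup_upper bdd_above_planar_radii) auto

lemma has_planar_minimal_set_below_r_bif:
  assumes "s < r_bif c"
  shows "has_planar_minimal_set (poly_semigroup (cball c s))"
proof -
  obtain t where "s < t" "has_planar_minimal_set (poly_semigroup (cball c t))"
    using assms has_planar_minimal_set_cball_0 unfolding r_bif_def
    by (subst (asm) less_cSup_iff) (auto simp: bdd_above_planar_radii)
  then show ?thesis by (auto intro: has_planar_minimal_set_mono subset_cball)
qed

text \<open>Invariant sets for radii increasing to \<open>r_bif c\<close> lie in one disc, and a
  limit of points chosen in them is the required point. The ball is open so that each finite word
  over it eventually lies in the smaller closed balls.\<close>

lemma invariant_core_ball_r_bif_nonempty:
  assumes "0 < r_bif c"
  shows "invariant_core (ball c (r_bif c)) (cmod c + 2) \<noteq> {}"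
proof -
  define r where "r = r_bif c"
  define s where "s j = r * (1 - 1 / (real j + 1))" for j :: nat
  have s: "0 \<le> s j" "s j < r" for j
    using assms by (auto simp: s_def r_def)
  have s_lim: "s \<longlonglongrightarrow> r"
    unfolding s_def by real_asymp
  have "\<exists>L. L \<noteq> {} \<and> compact L \<and> (\<forall>c'\<in>cball c (s j). fq c' ` L \<subseteq> L)" for j
    using has_planar_minimal_set_below_r_bif[of "s j" c] s[of j]
    unfolding has_planar_minimal_set_iff r_def by blast
  then obtain L where L: "\<And>j. L j \<noteq> {}" "\<And>j. compact (L j)"
      "\<And>j. \<forall>c'\<in>cball c (s j). fq c' ` L j \<subseteq> L j"
    by metis
  have L_sub: "L j \<subseteq> cball 0 (cmod c + 2)" for j
    using L s by (intro compact_invariant_subset_cball) auto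
  define z where "z j = (SOME w. w \<in> L j)" for j
  have z: "z j \<in> L j" for j
    unfolding z_def using L(1) by (simp add: some_in_eq)
  have "seq_compact (cball (0::complex) (cmod c + 2))"
    using compact_cball compact_imp_seq_compact by blast
  then obtain l \<phi> where \<phi>: "strict_mono \<phi>" "(z \<circ> \<phi>) \<longlonglongrightarrow> l"
    using z L_sub unfolding seq_compact_def by (metis subsetD)
  have "l \<in> invariant_core (ball c r) (cmod c + 2)"
    unfolding invariant_core_def
  proof (clarify)
    fix \<omega> :: "nat \<Rightarrow> complex" and n :: nat
    assume \<omega>: "\<forall>i<n. \<omega> i \<in> ball c r"
    have "\<forall>\<^sub>F j in sequentially. \<forall>i\<in>{..<n}. dist c (\<omega> i) < s j"
      using \<omega> by (intro eventually_ball_finite ballI order_tendstoD(1)[OF s_lim]) auto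
    then have ev: "\<forall>\<^sub>F j in sequentially. \<forall>i\<in>{..<n}. dist c (\<omega> i) < s (\<phi> j)"
      using \<phi>(1) eventually_subseq by blast
    have "\<forall>\<^sub>F j in sequentially. cmod (iter_seq \<omega> n (z (\<phi> j))) \<le> cmod c + 2"
      using ev
    proof eventually_elim
      case (elim j)
      have "iter_seq \<omega> n (z (\<phi> j)) \<in> L (\<phi> j)"
        by (rule iter_seq_mem_invariant[OF L(3)]) (use elim z in \<open>auto intro: less_imp_le\<close>)
      then show ?case using L_sub by fastforce
    qed
    moreover have "(\<lambda>j. cmod (iter_seq \<omega> n (z (\<phi> j)))) \<longlonglongrightarrow> cmod (iter_seq \<omega> n l)"
      using \<phi>(2) by (intro tendsto_norm tendsto_iter_seq) (auto simp: o_def)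
    ultimately show "cmod (iter_seq \<omega> n l) \<le> cmod c + 2"
      using tendsto_upperbound trivial_limit_sequentially by blast
  qed
  then show ?thesis unfolding r_def by blast
qed

text \<open>For a positive radius the closed ball is the closure of the open one, and limits of
  parameters preserve invariance because the core is closed. For radius 0 the fixed point serves
  instead.\<close>

lemma has_planar_minimal_set_cball_r_bif:
  "has_planar_minimal_set (poly_semigroup (cball c (r_bif c)))"
proof (cases "r_bif c = 0")
  case True
  then show ?thesis by (simp only: has_planar_minimal_set_cball_0)
next
  case False
  then have pos: "0 < r_bif c" using r_bif_nonneg[of c] by linarith
  define K where "K = invariant_core (ball c (r_bif c)) (cmod c + 2)"
  have "compact K" unfolding K_def by (rule compact_invariant_core)
  have "fq c' z \<in> K" if "c' \<in> cball c (r_bif c)" "z \<in> K" for c' z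
  proof -
    have "c' \<in> closure (ball c (r_bif c))" using that pos by simp
    then obtain a where a: "\<And>n. a n \<in> ball c (r_bif c)" "a \<longlonglongrightarrow> c'"
      unfolding closure_sequential by blast
    have "fq (a n) z \<in> K" for n
      using fq_image_invariant_core[OF a(1)] that(2) unfolding K_def by blast
    moreover have "(\<lambda>n. fq (a n) z) \<longlonglongrightarrow> fq c' z"
      unfolding fq_def by (intro tendsto_intros a)
    ultimately show ?thesis
      by (rule closed_sequentially[OF compact_imp_closed[OF \<open>compact K\<close>]])
  qed
  then show ?thesis
    unfolding has_planar_minimal_set_iff
    using invariant_core_ball_r_bif_nonempty[OF pos] \<open>compact K\<close>
    by (intro exI[of _ K]) (auto simp: K_def)
qed

section \<open>Inverse branches\<close>

text \<open>By the maximum principle a loop in the component, together with its inside, stays in the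
  sublevel set and hence in the component. Every point off the component is thus outside the loop,
  where the winding number is 0.\<close>

lemma simply_connected_component_sublevel:
  assumes "h holomorphic_on UNIV"
  shows "simply_connected (connected_component_set {z. cmod (h z) < R} x)"
    (is "simply_connected ?W")
proof -
  have cont: "continuous_on A h" for A
    using assms holomorphic_on_imp_continuous_on continuous_on_subset by blast
  have "open {z. cmod (h z) < R}"
    by (intro open_Collect_less continuous_intros cont)
  then have "open ?W" by (rule open_connected_component)
  have "winding_number \<gamma> z = 0"
    if \<gamma>: "path \<gamma>" "path_image \<gamma> \<subseteq> ?W" "pathfinish \<gamma> = pathstart \<gamma>" and z: "z \<notin> ?W"
    for \<gamma> z
  proof -
    have clo: "closed (path_image \<gamma>)" "bounded (path_image \<gamma>)" and com: "compact (path_image \<gamma>)"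
      using \<gamma>(1) by (simp_all add: closed_path_image bounded_path_image compact_path_image)
    have "continuous_on (path_image \<gamma>) (\<lambda>z. cmod (h z))"
      by (intro continuous_intros cont)
    then obtain p where p: "p \<in> path_image \<gamma>" "\<And>y. y \<in> path_image \<gamma> \<Longrightarrow> cmod (h y) \<le> cmod (h p)"
      using continuous_attains_sup[OF com] path_image_nonempty by metis
    have "p \<in> {z. cmod (h z) < R}"
      using p \<gamma>(2) connected_component_subset by blast
    then have pR: "cmod (h p) < R" by simp
    have inside: "cmod (h y) \<le> cmod (h p)" if "y \<in> inside (path_image \<gamma>)" for y
    proof (rule maximum_modulus_frontier[where f = h and \<xi> = y and S = "inside (path_image \<gamma>)"])
      show "h holomorphic_on interior (inside (path_image \<gamma>))"
        using assms holomorphic_on_subset by blast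
      show "cmod (h z) \<le> cmod (h p)" if "z \<in> frontier (inside (path_image \<gamma>))" for z
        using that frontier_inside_subset[OF clo(1)] p(2) by blast
    qed (rule cont bounded_inside clo that)+
    have "path_image \<gamma> \<union> inside (path_image \<gamma>) \<subseteq> connected_component_set {z. cmod (h z) < R} p"
    proof (rule connected_component_maximal)
      show "connected (path_image \<gamma> \<union> inside (path_image \<gamma>))"
        by (intro connected_with_inside clo connected_path_image \<gamma>)
      show "path_image \<gamma> \<union> inside (path_image \<gamma>) \<subseteq> {z. cmod (h z) < R}"
        using p(2) inside pR by force
    qed (use p in auto)
    moreover have "connected_component_set {z. cmod (h z) < R} p = ?W"
      using p(1) \<gamma>(2) connected_component_eq by blast
    ultimately have "z \<in> outside (path_image \<gamma>)"
      using z inside_Un_outside[of "path_image \<gamma>"] by blast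
    then show ?thesis
      using winding_number_zero_in_outside \<gamma> by blast
  qed
  then show ?thesis
    using simply_connected_eq_winding_number_zero[OF \<open>open ?W\<close>] connected_connected_component
    by blast
qed

text \<open>The quotient \<open>v / u\<close> is continuous with values in \<open>{1, -1}\<close>,
  so it is constant on a connected set.\<close>

lemma connected_square_eq_sign:
  fixes u v :: "'a::topological_space \<Rightarrow> complex"
  assumes "connected C" "continuous_on C u" "continuous_on C v"
    and "\<And>z. z \<in> C \<Longrightarrow> u z ^ 2 = v z ^ 2" "\<And>z. z \<in> C \<Longrightarrow> v z \<noteq> 0"
  obtains s where "s ^ 2 = 1" "\<And>z. z \<in> C \<Longrightarrow> v z = s * u z"
proof -
  have sq: "(v z / u z) ^ 2 = 1" "u z \<noteq> 0" if "z \<in> C" for z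
    using assms(4,5)[OF that] by (auto simp: power_divide)
  then have "(\<lambda>z. v z / u z) ` C \<subseteq> {1, -1}"
    using power2_eq_1_iff by blast
  then have "finite ((\<lambda>z. v z / u z) ` C)"
    using finite_subset by blast
  moreover have "continuous_on C (\<lambda>z. v z / u z)"
    using assms sq by (intro continuous_intros) auto
  ultimately have "(\<lambda>z. v z / u z) constant_on C"
    using assms(1) continuous_finite_range_constant by blast
  then obtain s where s: "\<And>z. z \<in> C \<Longrightarrow> v z / u z = s"
    unfolding constant_on_def by blast
  show ?thesis
  proof (cases "C = {}")
    case True
    then show ?thesis using that[of 1] by simp
  next
    case False
    then obtain z where "z \<in> C" by blast
    then have "s ^ 2 = 1" using s sq by metis
    moreover have "v z = s * u z" if "z \<in> C" for z
      using s[OF that] sq[OF that] by auto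
    ultimately show ?thesis using that by blast
  qed
qed

text \<open>Every \<open>fq c\<close> has the single critical point 0, so the last assumption keeps
  all critical values of the iterate out of \<open>W\<close>. Induction peels off the first map: a
  branch for the remaining maps is lifted through \<open>fq (\<omega> 0)\<close> by a holomorphic
  square root on the simply connected \<open>W\<close>.\<close>

lemma inverse_branch_exists:
  assumes "open W" "simply_connected W"
    and "connected C" "iter_seq \<omega> m ` C \<subseteq> W"
    and "\<And>k. k < m \<Longrightarrow> iter_seq (\<lambda>i. \<omega> (k + i)) (m - k) 0 \<notin> W"
  shows "\<exists>g. g holomorphic_on W \<and> (\<forall>w\<in>W. iter_seq \<omega> m (g w) = w) \<and>
             (\<forall>z\<in>C. g (iter_seq \<omega> m z) = z)"
  using assms(3-5)
proof (induction m arbitrary: \<omega> C)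
  case 0
  then show ?case by (intro exI[of _ "\<lambda>z. z"]) auto
next
  case (Suc m)
  define \<omega>' where "\<omega>' = (\<lambda>i. \<omega> (1 + i))"
  have split: "iter_seq \<omega> (Suc m) z = iter_seq \<omega>' m (fq (\<omega> 0) z)" for z
    using iter_seq_add[of \<omega> 1 m z] by (simp add: \<omega>'_def)
  have cfq: "continuous_on C (fq (\<omega> 0))"
    unfolding fq_def by (intro continuous_intros)
  have "\<exists>g. g holomorphic_on W \<and> (\<forall>w\<in>W. iter_seq \<omega>' m (g w) = w) \<and>
             (\<forall>z\<in>fq (\<omega> 0) ` C. g (iter_seq \<omega>' m z) = z)"
  proof (rule Suc.IH)
    show "connected (fq (\<omega> 0) ` C)"
      using Suc.prems(1) cfq connected_continuous_image by blast
    show "iter_seq \<omega>' m ` fq (\<omega> 0) ` C \<subseteq> W"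
      using Suc.prems(2) split by auto
    fix k assume "k < m"
    then show "iter_seq (\<lambda>i. \<omega>' (k + i)) (m - k) 0 \<notin> W"
      using Suc.prems(3)[of "Suc k"] by (simp add: \<omega>'_def)
  qed
  then obtain g where g: "g holomorphic_on W" "\<And>w. w \<in> W \<Longrightarrow> iter_seq \<omega>' m (g w) = w"
    "\<And>z. z \<in> C \<Longrightarrow> g (iter_seq \<omega> (Suc m) z) = fq (\<omega> 0) z"
    using split by auto
  have crit: "iter_seq \<omega> (Suc m) 0 \<notin> W"
    using Suc.prems(3)[of 0] by simp
  have "g w - \<omega> 0 \<noteq> 0" if "w \<in> W" for w
  proof
    assume "g w - \<omega> 0 = 0"
    then have "g w = fq (\<omega> 0) 0" by (simp add: fq_def)
    then have "iter_seq \<omega> (Suc m) 0 = w" using g(2)[OF that] split by metis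
    then show False using crit that by blast
  qed
  moreover have "(\<lambda>w. g w - \<omega> 0) holomorphic_on W"
    by (intro holomorphic_intros g)
  moreover have "\<forall>f. f holomorphic_on W \<and> (\<forall>w\<in>W. f w \<noteq> 0) \<longrightarrow>
      (\<exists>q. q holomorphic_on W \<and> (\<forall>w\<in>W. f w = (q w)\<^sup>2))"
    using assms(2) simply_connected_eq_holomorphic_sqrt[OF assms(1)] by simp
  ultimately have "\<exists>q. q holomorphic_on W \<and> (\<forall>w\<in>W. g w - \<omega> 0 = (q w)\<^sup>2)"
    by simp
  then obtain q where q: "q holomorphic_on W" "\<And>w. w \<in> W \<Longrightarrow> g w - \<omega> 0 = q w ^ 2"
    by blast
  define F where "F = iter_seq \<omega> (Suc m)"
  have FW: "F z \<in> W" if "z \<in> C" for z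
    using Suc.prems(2) that unfolding F_def by blast
  have "continuous_on C F"
    unfolding F_def by (rule continuous_on_iter_seq)
  then have "continuous_on C (\<lambda>z. q (F z))"
    by (rule continuous_on_compose2[OF holomorphic_on_imp_continuous_on[OF q(1)]])
      (use FW in auto)
  moreover have "q (F z) ^ 2 = z ^ 2" if "z \<in> C" for z
    unfolding q(2)[OF FW[OF that], symmetric] g(3)[OF that, folded F_def] by (simp add: fq_def)
  moreover have "z \<noteq> 0" if "z \<in> C" for z
    using FW[OF that] crit by (auto simp: F_def)
  \<comment> \<open>On the connected set \<open>C\<close>, which misses 0, the root agrees with the
    identity up to one constant sign; multiplying by that sign makes the branch return to
    \<open>C\<close>.\<close>
  ultimately obtain s where s: "s ^ 2 = 1" "\<And>z. z \<in> C \<Longrightarrow> z = s * q (F z)"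
    using connected_square_eq_sign[OF Suc.prems(1), of "\<lambda>z. q (F z)" "\<lambda>z. z"]
      continuous_on_id by metis
  have "F (s * q w) = w" if "w \<in> W" for w
  proof -
    have "fq (\<omega> 0) (s * q w) = g w"
      unfolding fq_def power_mult_distrib s(1) q(2)[OF that, symmetric] by simp
    then show ?thesis unfolding F_def split using g(2)[OF that] by simp
  qed
  moreover have "(\<lambda>w. s * q w) holomorphic_on W"
    by (intro holomorphic_intros q)
  ultimately show ?case
    using s(2) unfolding F_def[symmetric] by (intro exI[of _ "\<lambda>w. s * q w"] conjI ballI) simp_all
qed

section \<open>Limits of finite blocks of maps\<close>

lemma uniform_limit_iter_seq:
  assumes "\<And>i. i < n \<Longrightarrow> (\<lambda>j. \<omega> j i) \<longlonglongrightarrow> l i" "compact K"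
  shows "uniform_limit K (\<lambda>j. iter_seq (\<omega> j) n) (iter_seq l n) sequentially"
  using assms(1)
proof (induction n)
  case 0
  then show ?case by (simp add: uniform_limit_const)
next
  case (Suc n)
  \<comment> \<open>Boundedness of the limit on \<open>K\<close> lets uniform convergence pass to
    squares.\<close>
  have b: "bounded (iter_seq l n ` K)"
    using assms(2) compact_continuous_image continuous_on_iter_seq compact_imp_bounded by blast
  have "uniform_limit K (\<lambda>j z. \<omega> j n) (\<lambda>z. l n) sequentially"
    using Suc.prems[of n] by (auto simp: uniform_limit_iff tendsto_iff)
  moreover have "uniform_limit K (\<lambda>j z. iter_seq (\<omega> j) n z * iter_seq (\<omega> j) n z)
      (\<lambda>z. iter_seq l n z * iter_seq l n z) sequentially"
    using Suc b by (intro uniform_lim_mult) auto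
  ultimately have "uniform_limit K (\<lambda>j z. iter_seq (\<omega> j) n z * iter_seq (\<omega> j) n z + \<omega> j n)
      (\<lambda>z. iter_seq l n z * iter_seq l n z + l n) sequentially"
    by (rule uniform_limit_add[rotated])
  then show ?case by (simp add: fq_def o_def power2_eq_square)
qed

text \<open>Bolzano-Weierstrass is applied to one coordinate at a time; each refinement keeps the
  limits found before.\<close>

lemma bounded_coordinates_convergent_subsequence:
  fixes x :: "nat \<Rightarrow> nat \<Rightarrow> complex"
  assumes "\<And>j i. cmod (x j i) \<le> B"
  shows "\<exists>\<phi> l. strict_mono \<phi> \<and> (\<forall>i<n. cmod (l i) \<le> B \<and> (\<lambda>j. x (\<phi> j) i) \<longlonglongrightarrow> l i)"
proof (induction n)
  case 0
  then show ?case by (intro exI[of _ id]) (auto simp: strict_mono_def)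
next
  case (Suc n)
  then obtain \<phi> l where \<phi>: "strict_mono \<phi>"
    "\<And>i. i < n \<Longrightarrow> cmod (l i) \<le> B \<and> (\<lambda>j. x (\<phi> j) i) \<longlonglongrightarrow> l i" by blast
  have "seq_compact (cball (0::complex) B)"
    using compact_cball compact_imp_seq_compact by blast
  moreover have "\<forall>j. x (\<phi> j) n \<in> cball 0 B" using assms by auto
  ultimately obtain y \<psi> where y: "y \<in> cball 0 B" "strict_mono \<psi>" "((\<lambda>j. x (\<phi> j) n) \<circ> \<psi>) \<longlonglongrightarrow> y"
    unfolding seq_compact_def by metis
  show ?case
  proof (intro exI[of _ "\<phi> \<circ> \<psi>"] exI[of _ "l(n := y)"] conjI allI impI)
    show "strict_mono (\<phi> \<circ> \<psi>)" using \<phi> y by (simp add: strict_mono_o)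
    fix i assume "i < Suc n"
    then show "cmod ((l(n := y)) i) \<le> B"
      using \<phi>(2)[of i] y(1) by (auto simp: less_Suc_eq)
    show "(\<lambda>j. x ((\<phi> \<circ> \<psi>) j) i) \<longlonglongrightarrow> (l(n := y)) i"
    proof (cases "i = n")
      case True
      then show ?thesis using y by (simp add: o_def)
    next
      case False
      then show ?thesis
        using \<open>i < Suc n\<close> LIMSEQ_subseq_LIMSEQ[OF conjunct2[OF \<phi>(2)[of i]] y(2)]
        by (simp add: o_def)
    qed
  qed
qed

section \<open>Connected sets of bounded orbits\<close>

text \<open>The third assumption says that, at infinitely many times \<open>n\<close>, every critical point born
  more than \<open>N\<close> steps earlier has already escaped.\<close>
lemma connected_bounded_orbit_subset_singleton:
  fixes \<omega> :: "nat \<Rightarrow> complex"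
  assumes bnd: "\<And>i. cmod (\<omega> i) \<le> \<rho>"
    and dense: "\<And>U. open U \<Longrightarrow> U \<noteq> {} \<Longrightarrow> \<exists>d\<in>U. \<exists>n. \<rho> + 5 < cmod (iter_seq \<omega> n d)"
    and crit: "\<exists>\<^sub>\<infinity>n. \<forall>k. k + N < n \<longrightarrow>
        (\<exists>i\<le>n - k. \<rho> + 5 < cmod (iter_seq (\<lambda>j. \<omega> (k + j)) i 0))"
    and C: "connected C" "\<And>z n. z \<in> C \<Longrightarrow> cmod (iter_seq \<omega> n z) \<le> \<rho> + 2"
  shows "\<exists>a. C \<subseteq> {a}"
proof (cases "C = {}")
  case False
  then obtain z0 where z0: "z0 \<in> C" by blast
  have "\<exists>m :: nat \<Rightarrow> nat. strict_mono m \<and> (\<forall>j k. k < m j \<longrightarrow>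
      \<rho> + 5 < cmod (iter_seq (\<lambda>i. \<omega> (k + i)) (m j - k + N) 0))"
  proof -
    define A where "A = {n. \<forall>k. k + N < n \<longrightarrow>
        (\<exists>i\<le>n - k. \<rho> + 5 < cmod (iter_seq (\<lambda>j. \<omega> (k + j)) i 0))}"
    have "infinite A" using crit by (simp add: A_def frequently_cofinite)
    then obtain e :: "nat \<Rightarrow> nat" where e: "strict_mono e" "\<And>j. e j \<in> A"
      using infinite_enumerate by blast
    \<comment> \<open>The index shift ensures \<open>e (j + N) \<ge> N\<close>, so that the
      truncated subtraction is exact and \<open>m\<close> is strictly increasing.\<close>
    define m where "m j = e (j + N) - N" for j
    have eN: "e (j + N) = m j + N" for j
      using strict_mono_imp_increasing[OF e(1), of "j + N"] by (simp add: m_def)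
    have "strict_mono m"
    proof (rule strict_monoI)
      fix i j :: nat assume "i < j"
      then have "e (i + N) < e (j + N)" using e(1) by (simp add: strict_mono_less)
      then show "m i < m j" using eN by simp
    qed
    moreover have "\<rho> + 5 < cmod (iter_seq (\<lambda>i. \<omega> (k + i)) (m j - k + N) 0)" if "k < m j" for j k
    proof -
      have "m j + N \<in> A" using e(2)[of "j + N"] eN by simp
      moreover have "k + N < m j + N" using that by simp
      ultimately obtain i where
        "i \<le> m j + N - k" "\<rho> + 5 < cmod (iter_seq (\<lambda>j. \<omega> (k + j)) i 0)"
        unfolding A_def by blast
      then show ?thesis
        using that bnd by - (rule cmod_iter_seq_escaped[where \<rho> = \<rho> and n = i], simp_all)
    qed
    ultimately show ?thesis by blast
  qed
  then obtain m :: "nat \<Rightarrow> nat" where m: "strict_mono m"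
    "\<And>j k. k < m j \<Longrightarrow> \<rho> + 5 < cmod (iter_seq (\<lambda>i. \<omega> (k + i)) (m j - k + N) 0)"
    by blast
  \<comment> \<open>Coordinates below \<open>N\<close> hold the block of parameters after time
    \<open>m j\<close>, and coordinate \<open>N\<close> holds the position of \<open>z0\<close> at
    that time, so that one extraction makes both converge.\<close>
  define x where "x j i = (if i < N then \<omega> (m j + i) else iter_seq \<omega> (m j) z0)" for j i
  have "cmod (x j i) \<le> \<rho> + 2" for j i
    using C(2)[OF z0] bnd[of "m j + i"] by (simp add: x_def)
  from bounded_coordinates_convergent_subsequence[of x, OF this]
  obtain \<phi> :: "nat \<Rightarrow> nat" and l where \<phi>: "strict_mono \<phi>" "\<And>i. i < Suc N \<Longrightarrow> (\<lambda>j. x (\<phi> j) i) \<longlonglongrightarrow> l i"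
    by blast
  define M where "M j = m (\<phi> j)" for j
  have M: "strict_mono M"
    using m(1) \<phi>(1) by (auto simp: M_def strict_mono_def)
  have M_crit: "\<rho> + 5 < cmod (iter_seq (\<lambda>i. \<omega> (k + i)) (M j - k + N) 0)" if "k < M j" for j k
    using m(2) that by (simp add: M_def)
  have lim: "(\<lambda>j. \<omega> (M j + i)) \<longlonglongrightarrow> l i" if "i < N" for i
    using \<phi>(2)[of i] that by (simp add: x_def M_def)
  have lim_z0: "(\<lambda>j. iter_seq \<omega> (M j) z0) \<longlonglongrightarrow> l N"
    using \<phi>(2)[of N] by (simp add: x_def M_def)
  have l_le: "cmod (l i) \<le> \<rho>" if "i < N" for i
    by (rule Lim_norm_ubound[OF _ lim[OF that]]) (auto simp: bnd)
  define h where "h = iter_seq l N"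
  have h_cont: "continuous_on S h" for S
    unfolding h_def by (rule continuous_on_iter_seq)
  have iter_M: "iter_seq (\<lambda>i. \<omega> (M j + i)) N (iter_seq \<omega> (M j) z) = iter_seq \<omega> (M j + N) z" for j z
    by (simp add: iter_seq_add)
  have "cmod (h (l N)) \<le> \<rho> + 2"
  proof (rule Lim_norm_ubound)
    show "(\<lambda>j. iter_seq (\<lambda>i. \<omega> (M j + i)) N (iter_seq \<omega> (M j) z0)) \<longlonglongrightarrow> h (l N)"
      unfolding h_def by (rule tendsto_iter_seq) (auto intro: lim lim_z0)
  qed (use C(2)[OF z0] in \<open>auto simp: iter_M\<close>)
  \<comment> \<open>Radii: bounded orbits stay within \<open>\<rho> + 2\<close>, and replacing the blocks of \<open>\<omega>\<close> by their limit
    \<open>l\<close> costs at most 1, once to place the image of \<open>C\<close> in a compact part of \<open>W\<close> (radius \<open>\<rho> + 3\<close>)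
    and once to keep \<open>W\<close> (radius \<open>\<rho> + 4\<close>) free of escaped critical values (radius \<open>\<rho> + 5\<close>).\<close>
  define Q where "Q = {z. cmod (h z) < \<rho> + 4}"
  define W where "W = connected_component_set Q (l N)"
  have lN: "l N \<in> Q" using \<open>cmod (h (l N)) \<le> \<rho> + 2\<close> by (simp add: Q_def)
  have "open Q"
    unfolding Q_def by (intro open_Collect_less continuous_intros h_cont)
  then have W: "open W" "l N \<in> W" "W \<subseteq> Q" "connected W"
    using lN by (auto simp: W_def open_connected_component connected_component_subset)
  have W_sc: "simply_connected W"
    unfolding W_def Q_def h_def
    by (intro simply_connected_component_sublevel holomorphic_intros)
  \<comment> \<open>Beyond the escape radius \<open>h\<close> cannot decrease the modulus.\<close>
  have h_small: "cmod y \<le> \<rho> + 4" if "cmod (h y) \<le> \<rho> + 4" for y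
  proof (rule ccontr)
    assume "\<not> cmod y \<le> \<rho> + 4"
    then have "cmod y \<le> cmod (h y)"
      unfolding h_def by (intro cmod_iter_seq_ge_self[where \<rho> = \<rho>] l_le) auto
    then show False using that \<open>\<not> cmod y \<le> \<rho> + 4\<close> by linarith
  qed
  have W_small: "cmod y \<le> \<rho> + 4" if "y \<in> W" for y
    using h_small[of y] that W(3) by (auto simp: Q_def)
  have "uniform_limit (cball 0 (\<rho> + 4)) (\<lambda>j. iter_seq (\<lambda>i. \<omega> (M j + i)) N) h sequentially"
    unfolding h_def by (intro uniform_limit_iter_seq lim) auto
  then have "\<forall>\<^sub>F j in sequentially. \<forall>y\<in>cball 0 (\<rho> + 4).
      dist (iter_seq (\<lambda>i. \<omega> (M j + i)) N y) (h y) < 1"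
    by (rule uniform_limitD) simp
  moreover have "\<forall>\<^sub>F j in sequentially. iter_seq \<omega> (M j) z0 \<in> W"
    using lim_z0 W(1,2) by (rule topological_tendstoD)
  ultimately have "\<forall>\<^sub>F j in sequentially. iter_seq \<omega> (M j) z0 \<in> W \<and> (\<forall>y\<in>cball 0 (\<rho> + 4).
      dist (iter_seq (\<lambda>i. \<omega> (M j + i)) N y) (h y) < 1)"
    by eventually_elim simp
  then obtain J where J: "\<And>j. j \<ge> J \<Longrightarrow> iter_seq \<omega> (M j) z0 \<in> W"
    "\<And>j y. j \<ge> J \<Longrightarrow> cmod y \<le> \<rho> + 4 \<Longrightarrow> dist (iter_seq (\<lambda>i. \<omega> (M j + i)) N y) (h y) < 1"
    unfolding eventually_sequentially by (metis mem_cball_0)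
  define W0 where "W0 = W \<inter> {y. cmod (h y) \<le> \<rho> + 3}"
  \<comment> \<open>\<open>W\<close> is closed relative to \<open>Q\<close>, and the level
    \<open>\<rho> + 3\<close> below \<open>\<rho> + 4\<close> keeps \<open>W0\<close> away from the
    boundary of \<open>Q\<close>.\<close>
  have "compact W0"
  proof -
    have "closed {y. cmod (h y) \<le> \<rho> + 3}"
      by (intro closed_Collect_le continuous_intros h_cont)
    moreover have "{y. cmod (h y) \<le> \<rho> + 3} \<subseteq> cball 0 (\<rho> + 4)"
      using h_small by force
    ultimately have "compact {y. cmod (h y) \<le> \<rho> + 3}"
      using bounded_cball bounded_subset compact_eq_bounded_closed by blast
    moreover have "closedin (top_of_set Q) W"
      unfolding W_def by (rule closedin_connected_component)
    then obtain T where "closed T" "W = Q \<inter> T"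
      unfolding closedin_closed by blast
    then have "W0 = {y. cmod (h y) \<le> \<rho> + 3} \<inter> T"
      by (auto simp: W0_def Q_def)
    ultimately show ?thesis using \<open>closed T\<close> compact_Int_closed by metis
  qed
  have img: "iter_seq \<omega> (M j) ` C \<subseteq> W0" if j: "j \<ge> J" for j
  proof -
    have le: "cmod (h (iter_seq \<omega> (M j) z)) < \<rho> + 3" if "z \<in> C" for z
    proof -
      have "cmod (iter_seq \<omega> (M j) z) \<le> \<rho> + 4"
        using C(2)[OF that, of "M j"] by linarith
      then have "dist (iter_seq \<omega> (M j + N) z) (h (iter_seq \<omega> (M j) z)) < 1"
        using J(2)[OF j] iter_M by metis
      moreover have "cmod (iter_seq \<omega> (M j + N) z) \<le> \<rho> + 2" by (rule C(2)[OF that])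
      ultimately show ?thesis
        using norm_triangle_sub[of "h (iter_seq \<omega> (M j) z)" "iter_seq \<omega> (M j + N) z"]
        by (simp add: dist_norm norm_minus_commute)
    qed
    \<comment> \<open>The image of \<open>C\<close> is connected, lies in \<open>Q\<close> and
      contains the image of \<open>z0\<close>, so it stays in the component of that point.\<close>
    have "iter_seq \<omega> (M j) ` C \<subseteq> connected_component_set Q (iter_seq \<omega> (M j) z0)"
    proof (rule connected_component_maximal)
      show "connected (iter_seq \<omega> (M j) ` C)"
        by (intro connected_continuous_image continuous_on_iter_seq C)
      show "iter_seq \<omega> (M j) ` C \<subseteq> Q"
        using le by (force simp: Q_def)
    qed (use z0 in auto)
    also have "\<dots> = W"
      using J(1)[OF j] connected_component_eq unfolding W_def by blast
    finally show ?thesis using le by (force simp: W0_def)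
  qed
  have "\<exists>g. g holomorphic_on W \<and> (\<forall>w\<in>W. iter_seq \<omega> (M j) (g w) = w) \<and>
             (\<forall>z\<in>C. g (iter_seq \<omega> (M j) z) = z)" if j: "j \<ge> J" for j
  proof (rule inverse_branch_exists[OF W(1) W_sc C(1)])
    show "iter_seq \<omega> (M j) ` C \<subseteq> W" using img[OF j] by (auto simp: W0_def)
    fix k assume k: "k < M j"
    define y where "y = iter_seq (\<lambda>i. \<omega> (k + i)) (M j - k) 0"
    have "iter_seq (\<lambda>i. \<omega> (k + i)) (M j - k + N) 0 = iter_seq (\<lambda>i. \<omega> (M j + i)) N y"
      unfolding y_def iter_seq_add using k by (simp add: add.assoc[symmetric])
    then have gt: "\<rho> + 5 < cmod (iter_seq (\<lambda>i. \<omega> (M j + i)) N y)"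
      using M_crit[OF k] by simp
    \<comment> \<open>A critical orbit found in \<open>W\<close> at time \<open>M j\<close> would
      have modulus below \<open>\<rho> + 5\<close> after \<open>N\<close> more steps, although it
      has escaped by then.\<close>
    show "iter_seq (\<lambda>i. \<omega> (k + i)) (M j - k) 0 \<notin> W"
    proof
      assume "iter_seq (\<lambda>i. \<omega> (k + i)) (M j - k) 0 \<in> W"
      then have y: "y \<in> W" by (simp add: y_def)
      then have "dist (iter_seq (\<lambda>i. \<omega> (M j + i)) N y) (h y) < 1"
        using J(2)[OF j] W_small by blast
      moreover have "cmod (h y) < \<rho> + 4" using y W(3) by (auto simp: Q_def)
      ultimately show False
        using gt norm_triangle_sub[of "iter_seq (\<lambda>i. \<omega> (M j + i)) N y" "h y"]
        by (simp add: dist_norm)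
    qed
  qed
  then have "\<forall>j. \<exists>g. g holomorphic_on W \<and> (\<forall>w\<in>W. iter_seq \<omega> (M (j + J)) (g w) = w) \<and>
             (\<forall>z\<in>C. g (iter_seq \<omega> (M (j + J)) z) = z)"
    by simp
  then obtain G where G: "\<And>j. G j holomorphic_on W"
    "\<And>j w. w \<in> W \<Longrightarrow> iter_seq \<omega> (M (j + J)) (G j w) = w"
    "\<And>j z. z \<in> C \<Longrightarrow> G j (iter_seq \<omega> (M (j + J)) z) = z"
    by metis
  \<comment> \<open>A point that had left the disc of radius \<open>\<rho> + 4\<close> could not be
    in \<open>W\<close> at time \<open>M (j + J)\<close>. Time 0 gives the bound for Montel's
    theorem, general \<open>n\<close> the bounded orbits of limits.\<close>
  have G_bnd: "cmod (iter_seq \<omega> n (G j w)) \<le> \<rho> + 4" if "w \<in> W" "n \<le> M (j + J)" for n j w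
  proof (rule ccontr)
    assume "\<not> cmod (iter_seq \<omega> n (G j w)) \<le> \<rho> + 4"
    then have "\<rho> + 4 < cmod (iter_seq \<omega> (M (j + J)) (G j w))"
      using that(2) bnd by - (rule cmod_iter_seq_escaped[where \<rho> = \<rho> and n = n], simp_all)
    then show False using G(2)[OF that(1)] W_small[OF that(1)] by simp
  qed
  have G_ub: "\<exists>B. \<forall>h\<in>range G. \<forall>z\<in>K. cmod (h z) \<le> B" if "K \<subseteq> W" for K
    using G_bnd[of _ 0] that by (intro exI[of _ "\<rho> + 4"]) auto
  obtain g r where g: "g holomorphic_on W" and r: "strict_mono (r :: nat \<Rightarrow> nat)"
    and pt: "\<And>w. w \<in> W \<Longrightarrow> (\<lambda>j. G (r j) w) \<longlonglongrightarrow> g w"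
    and un: "\<And>K. compact K \<Longrightarrow> K \<subseteq> W \<Longrightarrow> uniform_limit K (G \<circ> r) g sequentially"
  proof (rule Montel[OF W(1), of "range G" G])
    show "h holomorphic_on W" if "h \<in> range G" for h
      using that G(1) by auto
    show "\<exists>B. \<forall>h\<in>range G. \<forall>z\<in>K. cmod (h z) \<le> B" if "K \<subseteq> W" for K
      using that by (rule G_ub)
  qed (rule order_refl, rule that)
  \<comment> \<open>Otherwise \<open>g ` W\<close> would be an open set of points with bounded orbits.\<close>
  have "g constant_on W"
  proof (rule ccontr)
    assume "\<not> g constant_on W"
    then have "open (g ` W)"
      using open_mapping_thm[OF g W(1) W(4) W(1) order_refl] by simp
    then obtain w n where w: "w \<in> W" "\<rho> + 5 < cmod (iter_seq \<omega> n (g w))"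
      using dense[of "g ` W"] W(2) by blast
    have "\<forall>\<^sub>F j in sequentially. n \<le> j" by (rule eventually_ge_at_top)
    then have "\<forall>\<^sub>F j in sequentially. cmod (iter_seq \<omega> n (G (r j) w)) \<le> \<rho> + 4"
    proof eventually_elim
      case (elim j)
      have "n \<le> r j + J" using elim strict_mono_imp_increasing[OF r, of j] by linarith
      also have "\<dots> \<le> M (r j + J)" by (rule strict_mono_imp_increasing[OF M])
      finally show ?case by (rule G_bnd[OF w(1)])
    qed
    then have "cmod (iter_seq \<omega> n (g w)) \<le> \<rho> + 4"
      by (rule Lim_norm_ubound[OF sequentially_bot tendsto_iter_seq[OF tendsto_const pt[OF w(1)]]])
    then show False using w(2) by simp
  qed
  then obtain q where q: "\<And>w. w \<in> W \<Longrightarrow> g w = q"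
    unfolding constant_on_def by blast
  \<comment> \<open>The iterates of \<open>z\<close> at the chosen times lie in the compact
    \<open>W0\<close>, where the branches tend uniformly to \<open>q\<close>; yet each branch sends
    the iterate back to \<open>z\<close>.\<close>
  have "z = q" if z: "z \<in> C" for z
  proof (rule ccontr)
    assume "z \<noteq> q"
    have lim: "uniform_limit W0 (G \<circ> r) g sequentially"
      by (rule un[OF \<open>compact W0\<close>]) (auto simp: W0_def)
    have "\<forall>\<^sub>F j in sequentially. \<forall>w\<in>W0. dist (G (r j) w) (g w) < dist z q"
      using \<open>z \<noteq> q\<close> uniform_limitD[OF lim, of "dist z q"] by simp
    then obtain j where j: "\<And>w. w \<in> W0 \<Longrightarrow> dist (G (r j) w) (g w) < dist z q"
      unfolding eventually_sequentially by blast
    have "iter_seq \<omega> (M (r j + J)) z \<in> W0"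
      using img[of "r j + J"] z by auto
    then show False
      using j[of "iter_seq \<omega> (M (r j + J)) z"] G(3)[OF z, of "r j"] q
      by (simp add: W0_def)
  qed
  then show ?thesis by blast
qed auto

section \<open>Julia sets and escaping orbits\<close>

lemma normal_family_iter_seq_escaping:
  assumes bnd: "\<And>i. cmod (\<omega> i) \<le> \<rho>"
    and esc: "\<And>z. z \<in> U \<Longrightarrow> \<rho> + 2 < cmod (iter_seq \<omega> n z)"
  shows "normal_family {iter_seq \<omega> n | n. n \<ge> 1} U"
  unfolding normal_family_def
proof (intro allI impI)
  fix s :: "nat \<Rightarrow> complex \<Rightarrow> complex"
  assume "\<forall>k. s k \<in> {iter_seq \<omega> n | n. n \<ge> 1}"
  then have "\<forall>k. \<exists>n. s k = iter_seq \<omega> n" by blast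
  then obtain a where a: "\<And>k. s k = iter_seq \<omega> (a k)" by metis
  \<comment> \<open>Either the indices tend to infinity, and the maps tend to infinity uniformly on
    \<open>U\<close>, or some index recurs infinitely often, which gives a constant
    subsequence.\<close>
  show "\<exists>r g. strict_mono r \<and> (\<forall>K. compact K \<and> K \<subseteq> U \<longrightarrow>
      (\<forall>e>0. \<forall>\<^sub>F j in sequentially. \<forall>z\<in>K. chordal (Some (s (r j) z)) (g z) < e))"
  proof (cases "filterlim a at_top sequentially")
    case True
    have lim: "\<forall>\<^sub>F j in sequentially. \<forall>z\<in>U. chordal (Some (s j z)) None < e" if "e > 0" for e
    proof -
      \<comment> \<open>After time \<open>n\<close> each step doubles a modulus that is at least 1,
        so \<open>p\<close> further steps bring the chordal distance to infinity below
        \<open>e\<close>.\<close>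
      obtain p where p: "2 / e < 2 ^ p" using real_arch_pow[of 2 "2 / e"] by auto
      have "\<forall>\<^sub>F j in sequentially. n + p \<le> a j"
        using True filterlim_at_top by blast
      then show ?thesis
      proof eventually_elim
        case (elim j)
        show ?case
        proof
          fix z assume z: "z \<in> U"
          define y where "y = iter_seq \<omega> n z"
          have y: "\<rho> + 2 < cmod y" "1 \<le> cmod y"
            using esc[OF z] norm_ge_zero[of "\<omega> 0"] bnd[of 0] unfolding y_def by linarith+
          have "(2::real) ^ p * 1 \<le> 2 ^ (a j - n) * cmod y"
            using elim y by (intro mult_mono power_increasing) auto
          also have "\<dots> \<le> cmod (iter_seq (\<lambda>i. \<omega> (n + i)) (a j - n) y)"
            using y bnd by (intro cmod_iter_seq_ge[where \<rho> = \<rho>]) auto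
          also have "\<dots> = cmod (s j z)"
            using iter_seq_add[of \<omega> n "a j - n" z] elim by (simp add: a y_def)
          also have "\<dots> \<le> sqrt (1 + (cmod (s j z))\<^sup>2)"
            by (rule real_le_rsqrt) simp
          finally have "2 / e < sqrt (1 + (cmod (s j z))\<^sup>2)" using p by simp
          moreover have "0 < sqrt (1 + (cmod (s j z))\<^sup>2)"
            by (simp add: add_pos_nonneg)
          ultimately show "chordal (Some (s j z)) None < e"
            using that by (simp add: field_simps)
        qed
      qed
    qed
    show ?thesis
    proof (intro exI[of _ id] exI[of _ "\<lambda>_. None"] conjI allI impI)
      fix K and e :: real assume "compact K \<and> K \<subseteq> U" "0 < e"
      then show "\<forall>\<^sub>F j in sequentially. \<forall>z\<in>K. chordal (Some (s (id j) z)) None < e"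
        using lim[of e] by (auto elim!: eventually_mono)
    qed (simp add: strict_mono_def)
  next
    case False
    then obtain B where "\<not> (\<forall>\<^sub>F k in sequentially. B \<le> a k)"
      unfolding filterlim_at_top by blast
    then have "infinite {k. a k < B}"
      by (simp add: not_eventually not_le frequently_cofinite flip: cofinite_eq_sequentially)
    moreover have "a ` {k. a k < B} \<subseteq> {..<B}" by auto
    then have "finite (a ` {k. a k < B})" using finite_subset by blast
    ultimately obtain k0 where "infinite {k \<in> {k. a k < B}. a k = a k0}"
      using pigeonhole_infinite by blast
    then have "infinite {k. a k = a k0}"
      by (rule infinite_super[rotated]) auto
    then obtain r :: "nat \<Rightarrow> nat" where r: "strict_mono r" "\<And>j. a (r j) = a k0"
      using infinite_enumerate by blast
    have "s (r j) = s k0" for j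
      by (simp add: a r)
    then show ?thesis
      using r(1) by (intro exI[of _ r] exI[of _ "\<lambda>z. Some (s k0 z)"]) simp
  qed
qed

text \<open>Escape at time \<open>n\<close> persists on a neighbourhood of the point, and the
  iterates are normal there.\<close>

lemma random_julia_bounded_orbit:
  assumes "\<And>i. cmod (\<omega> i) \<le> \<rho>" "z \<in> random_julia \<omega>"
  shows "cmod (iter_seq \<omega> n z) \<le> \<rho> + 2"
proof (rule ccontr)
  assume *: "\<not> cmod (iter_seq \<omega> n z) \<le> \<rho> + 2"
  define U where "U = {y. \<rho> + 2 < cmod (iter_seq \<omega> n y)}"
  have "open U"
    unfolding U_def by (intro open_Collect_less continuous_intros continuous_on_iter_seq)
  moreover have "z \<in> U" using * by (simp add: U_def)
  moreover have "normal_family {iter_seq \<omega> n | n. n \<ge> 1} U"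
    by (rule normal_family_iter_seq_escaping[where \<rho> = \<rho> and n = n]) (auto simp: U_def assms)
  ultimately show False
    using assms(2) unfolding random_julia_def by blast
qed

section \<open>Escape probabilities\<close>

text \<open>Imposing the bound at all times up to \<open>n\<close> makes these events decrease in
  \<open>n\<close> for every \<open>R\<close>. They depend on the first \<open>n\<close> parameters
  only.\<close>

definition surviving :: "real \<Rightarrow> nat \<Rightarrow> complex \<Rightarrow> (nat \<Rightarrow> complex) set" where
  "surviving R n z = {\<omega>. \<forall>k\<le>n. cmod (iter_seq \<omega> k z) \<le> R}"

lemma surviving_antimono: "m \<le> n \<Longrightarrow> surviving R n z \<subseteq> surviving R m z"
  by (auto simp: surviving_def)

text \<open>Markov property along paths: \<open>comb_seq i\<close> plays the first \<open>i\<close>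
  letters of \<omega> and then \<open>\<omega>'\<close>, so survival restarts at the point reached
  at time \<open>i\<close>.\<close>

lemma comb_seq_mem_surviving:
  assumes "comb_seq i \<omega> \<omega>' \<in> surviving R (i + n) z"
  shows "\<omega> \<in> surviving R i z" "\<omega>' \<in> surviving R n (iter_seq \<omega> i z)"
proof -
  have pre: "iter_seq (comb_seq i \<omega> \<omega>') k z = iter_seq \<omega> k z" if "k \<le> i" for k
    using that by (intro iter_seq_cong) (simp add: comb_seq_def)
  have le: "cmod (iter_seq (comb_seq i \<omega> \<omega>') k z) \<le> R" if "k \<le> i + n" for k
    using assms that by (simp add: surviving_def)
  show "\<omega> \<in> surviving R i z"
    unfolding surviving_def
  proof clarify
    fix k assume "k \<le> i"
    then show "cmod (iter_seq \<omega> k z) \<le> R" using le[of k] pre[of k] by simp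
  qed
  have "iter_seq (comb_seq i \<omega> \<omega>') (i + k) z = iter_seq \<omega>' k (iter_seq \<omega> i z)" for k
    by (simp add: iter_seq_add pre comb_seq_def)
  then show "\<omega>' \<in> surviving R n (iter_seq \<omega> i z)"
    unfolding surviving_def using le[of "i + _"] by simp
qed

lemma (in prob_space) AE_not_mem_if_prob_le_null_seq:
  assumes "A \<in> events" "\<And>n. prob A \<le> x n" "x \<longlonglongrightarrow> 0"
  shows "AE \<omega> in M. \<omega> \<notin> A"
proof -
  have "prob A \<le> 0"
    using assms(2) by (intro LIMSEQ_le_const[OF assms(3)]) auto
  then have "prob A = 0" by (simp add: measure_le_0_iff)
  then show ?thesis
    using assms(1) prob_eq_0 by blast
qed

lemma sum_geometric_reversed_le:
  fixes l :: real
  assumes "0 < l" "l < 1"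
  shows "(\<Sum>k<m. l ^ (m - k)) \<le> 1 / (1 - l)"
proof -
  have "(\<Sum>k<m. l ^ (m - k)) = (\<Sum>k<m. l ^ Suc k)"
    using sum.nat_diff_reindex[of "\<lambda>k. l ^ Suc k" m]
    by (simp add: Suc_diff_Suc del: power_Suc)
  also have "\<dots> \<le> (\<Sum>k<m. l ^ k)"
    using assms by (intro sum_mono) (simp add: mult_left_le_one_le)
  also have "\<dots> \<le> (\<Sum>k. l ^ k)"
    using assms by (intro sum_le_suminf summable_geometric) auto
  also have "\<dots> = 1 / (1 - l)" using assms by (intro suminf_geometric) auto
  finally show ?thesis .
qed

section \<open>Product measure: concatenation and shift\<close>

locale random_quadratic = sequence_space \<mu> for \<mu> :: "complex measure" +
  assumes sets_eq: "sets \<mu> = sets borel"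
begin

lemma space_S [simp]: "space S = UNIV"
proof -
  have "space \<mu> = UNIV" using sets_eq_imp_space_eq[OF sets_eq] by simp
  then show ?thesis by (simp add: space_PiM)
qed

lemma measurable_iter_seq [measurable]: "(\<lambda>\<omega>. iter_seq \<omega> n z) \<in> borel_measurable S"
proof (induction n)
  case (Suc n)
  have "(\<lambda>\<omega>. \<omega> n) \<in> measurable S \<mu>" by measurable
  then have [measurable]: "(\<lambda>\<omega>. \<omega> n) \<in> borel_measurable S"
    using measurable_cong_sets[OF refl sets_eq] by blast
  show ?case using Suc by (simp add: fq_def)
qed simp

lemma sets_surviving [measurable]: "surviving R n z \<in> sets S"
proof -
  have "{\<omega> \<in> space S. \<forall>k\<le>n. cmod (iter_seq \<omega> k z) \<le> R} \<in> sets S" by measurable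
  then show ?thesis by (simp add: surviving_def)
qed

text \<open>Joining the first \<open>i\<close> letters of one sample to an independent second sample
  reproduces the product measure. Integrating over the first sample, the second contributes at most
  \<open>q\<close> wherever the restart takes place.\<close>

lemma prob_surviving_add:
  assumes "\<And>z. prob (surviving R n z) \<le> q"
  shows "prob (surviving R (i + n) z) \<le> prob (surviving R i z) * q"
proof -
  have q: "0 \<le> q" using assms[of 0] measure_nonneg order_trans by blast
  let ?f = "\<lambda>(\<omega>, \<omega>'). comb_seq i \<omega> \<omega>'"
  define X where "X = ?f -` surviving R (i + n) z \<inter> space (S \<Otimes>\<^sub>M S)"
  have f: "?f \<in> measurable (S \<Otimes>\<^sub>M S) S" by (rule measurable_comb_seq)
  have X: "X \<in> sets (S \<Otimes>\<^sub>M S)"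
    unfolding X_def by (rule measurable_sets[OF f sets_surviving])
  have "emeasure S (surviving R (i + n) z) =
      emeasure (distr (S \<Otimes>\<^sub>M S) S ?f) (surviving R (i + n) z)"
    by (simp only: PiM_comb_seq)
  also have "\<dots> = emeasure (S \<Otimes>\<^sub>M S) X"
    unfolding X_def by (rule emeasure_distr[OF f sets_surviving])
  also have "\<dots> = (\<integral>\<^sup>+\<omega>. emeasure S (Pair \<omega> -` X) \<partial>S)"
    by (rule P.emeasure_pair_measure_alt[OF X])
  also have "\<dots> \<le> (\<integral>\<^sup>+\<omega>. ennreal q * indicator (surviving R i z) \<omega> \<partial>S)"
  proof (rule nn_integral_mono)
    fix \<omega>
    show "emeasure S (Pair \<omega> -` X) \<le> ennreal q * indicator (surviving R i z) \<omega>"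
    proof (cases "\<omega> \<in> surviving R i z")
      case True
      have "Pair \<omega> -` X \<subseteq> surviving R n (iter_seq \<omega> i z)"
        using comb_seq_mem_surviving(2) by (auto simp: X_def)
      then have "emeasure S (Pair \<omega> -` X) \<le> emeasure S (surviving R n (iter_seq \<omega> i z))"
        by (intro emeasure_mono sets_surviving)
      also have "\<dots> \<le> ennreal q"
        using assms by (simp add: emeasure_eq_measure ennreal_leI)
      finally show ?thesis using True by simp
    next
      case False
      then have "Pair \<omega> -` X = {}"
        using comb_seq_mem_surviving(1) by (auto simp: X_def)
      then show ?thesis by simp
    qed
  qed
  also have "\<dots> = ennreal q * emeasure S (surviving R i z)"
    by (simp add: nn_integral_cmult)
  also have "\<dots> = ennreal (prob (surviving R i z) * q)"
    using q by (simp add: emeasure_eq_measure ennreal_mult' mult.commute)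
  finally show ?thesis
    using q by (simp add: emeasure_eq_measure)
qed

text \<open>The shift is an injective reindexing, hence preserves the product measure. A critical
  orbit born at time \<open>k\<close> therefore has the same law as one born at time 0.\<close>

lemma prob_shift:
  assumes "A \<in> sets S"
  shows "{\<omega>. (\<lambda>j. \<omega> (k + j)) \<in> A} \<in> sets S" "prob {\<omega>. (\<lambda>j. \<omega> (k + j)) \<in> A} = prob A"
proof -
  let ?t = "\<lambda>\<omega> j. \<omega> (k + j)"
  have t: "?t \<in> measurable S S"
    by (rule measurable_PiM_single') (auto simp: space_PiM)
  have "distr S S (\<lambda>\<omega>. \<lambda>n\<in>UNIV. \<omega> (k + n)) = S"
    using distr_PiM_reindex[of UNIV "\<lambda>_. \<mu>" "\<lambda>j. k + j" UNIV] M.prob_space_axioms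
    by (simp add: inj_on_def)
  then have d: "distr S S ?t = S" by (simp add: restrict_UNIV)
  have v: "?t -` A \<inter> space S = {\<omega>. (\<lambda>j. \<omega> (k + j)) \<in> A}" by auto
  show "{\<omega>. (\<lambda>j. \<omega> (k + j)) \<in> A} \<in> sets S"
    using measurable_sets[OF t assms] v by simp
  show "prob {\<omega>. (\<lambda>j. \<omega> (k + j)) \<in> A} = prob A"
    using measure_distr[OF t assms] d v by simp
qed

section \<open>Uniform geometric decay of survival probabilities\<close>

lemma prob_surviving_locally_less_1:
  assumes "\<And>i. i < n \<Longrightarrow> w i \<in> msupp \<mu>" "R < cmod (iter_seq w n z0)"
  shows "\<exists>\<delta> q. 0 < \<delta> \<and> q < 1 \<and> (\<forall>z\<in>ball z0 \<delta>. prob (surviving R n z) \<le> q)"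
proof -
  \<comment> \<open>Escape at time \<open>n\<close> is an open condition jointly in the starting
    point and the word.\<close>
  have "\<exists>\<delta>>0. \<forall>z \<omega>. dist z z0 < \<delta> \<and> (\<forall>i<n. dist (\<omega> i) (w i) < \<delta>) \<longrightarrow> R < cmod (iter_seq \<omega> n z)"
  proof (rule ccontr)
    assume "\<not> ?thesis"
    then have "\<forall>j::nat. \<exists>z \<omega>. dist z z0 < inverse (Suc j) \<and>
        (\<forall>i<n. dist (\<omega> i) (w i) < inverse (Suc j)) \<and> cmod (iter_seq \<omega> n z) \<le> R"
      by (metis inverse_positive_iff_positive not_le of_nat_0_less_iff zero_less_Suc)
    then obtain z \<omega> where z: "\<And>j::nat. dist (z j) z0 < inverse (Suc j)"
      and \<omega>: "\<And>j i. i < n \<Longrightarrow> dist (\<omega> j i) (w i) < inverse (Suc j)"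
      and le: "\<And>j. cmod (iter_seq (\<omega> j) n (z j)) \<le> R"
      by metis
    have lim0: "(\<lambda>j. inverse (real (Suc j))) \<longlonglongrightarrow> 0" by (rule LIMSEQ_inverse_real_of_nat)
    have "(\<lambda>j. dist (z j) z0) \<longlonglongrightarrow> 0"
      by (rule tendsto_sandwich[OF _ _ tendsto_const lim0]) (auto intro!: always_eventually less_imp_le[OF z] simp del: of_nat_Suc)
    then have "z \<longlonglongrightarrow> z0" by (rule iffD2[OF tendsto_dist_iff])
    moreover have "(\<lambda>j. \<omega> j i) \<longlonglongrightarrow> w i" if "i < n" for i
    proof -
      have "(\<lambda>j. dist (\<omega> j i) (w i)) \<longlonglongrightarrow> 0"
        by (rule tendsto_sandwich[OF _ _ tendsto_const lim0])
          (auto intro!: always_eventually less_imp_le[OF \<omega>[OF that]] simp del: of_nat_Suc)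
      then show ?thesis by (rule iffD2[OF tendsto_dist_iff])
    qed
    ultimately have "(\<lambda>j. iter_seq (\<omega> j) n (z j)) \<longlonglongrightarrow> iter_seq w n z0"
      by (intro tendsto_iter_seq)
    then have "cmod (iter_seq w n z0) \<le> R"
      by (rule Lim_norm_ubound[OF sequentially_bot]) (simp add: le)
    then show False using assms(2) by simp
  qed
  then obtain \<delta> where \<delta>: "0 < \<delta>" "\<And>z \<omega>. dist z z0 < \<delta> \<Longrightarrow> (\<And>i. i < n \<Longrightarrow> dist (\<omega> i) (w i) < \<delta>) \<Longrightarrow>
      R < cmod (iter_seq \<omega> n z)"
    by metis
  \<comment> \<open>A cylinder of words near \<open>w\<close>; it has positive probability because
    each centre \<open>w i\<close> lies in the support.\<close>
  define E where "E = {\<omega> \<in> space S. \<forall>i\<in>{..<n}. \<omega> i \<in> ball (w i) \<delta>}"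
  have ball: "ball y \<delta> \<in> sets \<mu>" for y by (simp add: sets_eq)
  have E: "E \<in> sets S"
    unfolding E_def using ball by measurable
  have "emeasure S E = (\<Prod>i<n. emeasure \<mu> (ball (w i) \<delta>))"
    unfolding E_def by (rule emeasure_PiM_Collect) (auto simp: ball)
  moreover have "(\<Prod>i<n. emeasure \<mu> (ball (w i) \<delta>)) \<noteq> 0"
    using assms(1) \<delta>(1) by (force simp: msupp_def)
  ultimately have "emeasure S E \<noteq> 0" by simp
  then have "0 < prob E"
    by (simp add: emeasure_eq_measure zero_less_measure_iff)
  moreover have "prob (surviving R n z) \<le> 1 - prob E" if "z \<in> ball z0 \<delta>" for z
  proof -
    have "\<omega> \<notin> E" if "\<omega> \<in> surviving R n z" for \<omega>
    proof
      assume "\<omega> \<in> E"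
      then have "R < cmod (iter_seq \<omega> n z)"
        using \<open>z \<in> ball z0 \<delta>\<close> by (intro \<delta>(2)) (auto simp: E_def dist_commute)
      then show False using that by (auto simp: surviving_def)
    qed
    then have "surviving R n z \<subseteq> space S - E" by auto
    then have "prob (surviving R n z) \<le> prob (space S - E)"
      using E by (intro finite_measure_mono sets.compl_sets)
    then show ?thesis using E prob_compl by simp
  qed
  ultimately show ?thesis
    using \<delta>(1) by (intro exI[of _ \<delta>] exI[of _ "1 - prob E"]) auto
qed

text \<open>Finitely many of the local estimates cover the closed disc of radius \<open>R\<close>,
  and survival becomes less likely with time, so one time beyond all of theirs works
  everywhere.\<close>

lemma prob_surviving_uniformly_less_1:
  assumes esc: "\<And>z. \<exists>w n. (\<forall>i<n. w i \<in> msupp \<mu>) \<and> R < cmod (iter_seq w n z)"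
  shows "\<exists>N q. q < 1 \<and> (\<forall>z. prob (surviving R N z) \<le> q)"
proof -
  have "\<exists>n \<delta> q. 0 < \<delta> \<and> q < 1 \<and> (\<forall>z\<in>ball z0 \<delta>. prob (surviving R n z) \<le> q)" for z0
    using esc[of z0] prob_surviving_locally_less_1 by blast
  then obtain n \<delta> q where *: "\<And>z0. 0 < \<delta> z0" "\<And>z0. q z0 < (1::real)"
    "\<And>z0 z. z \<in> ball z0 (\<delta> z0) \<Longrightarrow> prob (surviving R (n z0) z) \<le> q z0"
    by metis
  have "cball 0 R \<subseteq> (\<Union>z0\<in>cball 0 R. ball z0 (\<delta> z0))"
    using *(1) by auto
  then obtain T where T: "T \<subseteq> cball 0 R" "finite T" "cball 0 R \<subseteq> (\<Union>z0\<in>T. ball z0 (\<delta> z0))"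
    using compactE_image[of "cball 0 R" "cball 0 R" "\<lambda>z0. ball z0 (\<delta> z0)"] by auto
  \<comment> \<open>The inserted 0 handles points outside the disc, which fail already at time 0,
    and an empty \<open>T\<close>.\<close>
  define Q where "Q = Max (insert 0 (q ` T))"
  define N where "N = (\<Sum>z0\<in>T. n z0)"
  have "Q < 1" using T(2) *(2) by (simp add: Q_def)
  moreover have "prob (surviving R N z) \<le> Q" for z
  proof (cases "z \<in> cball 0 R")
    case True
    then obtain z0 where z0: "z0 \<in> T" "z \<in> ball z0 (\<delta> z0)" using T(3) by blast
    have "n z0 \<le> N" unfolding N_def using T(2) z0(1) by (simp add: member_le_sum)
    then have "prob (surviving R N z) \<le> prob (surviving R (n z0) z)"
      by (intro finite_measure_mono surviving_antimono) auto
    also have "\<dots> \<le> q z0" by (rule *(3)[OF z0(2)])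
    also have "\<dots> \<le> Q" unfolding Q_def using T(2) z0(1) by (intro Max_ge) auto
    finally show ?thesis .
  next
    case False
    then have "surviving R N z = {}"
      by (force simp: surviving_def)
    then show ?thesis using T(2) by (simp add: Q_def)
  qed
  ultimately show ?thesis by blast
qed

text \<open>Chaining blocks of \<open>N\<close> steps gives \<open>q ^ k\<close> after
  \<open>k\<close> blocks. The \<open>N\<close>-th root of \<open>q\<close> is the rate per step,
  and the factor \<open>1 / q\<close> absorbs the incomplete last block.\<close>

lemma prob_surviving_geometric:
  assumes esc: "\<And>z. \<exists>w n. (\<forall>i<n. w i \<in> msupp \<mu>) \<and> R < cmod (iter_seq w n z)"
  shows "\<exists>B l. 0 < l \<and> l < 1 \<and> (\<forall>n z. prob (surviving R n z) \<le> B * l ^ n)"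
proof -
  obtain N0 q0 where q0: "q0 < 1" "\<And>z. prob (surviving R N0 z) \<le> q0"
    using prob_surviving_uniformly_less_1[OF esc] by blast
  \<comment> \<open>The successor makes \<open>N\<close> positive for the root and the division; the
    maximum with \<open>1 / 2\<close> makes \<open>q\<close> positive.\<close>
  define N where "N = Suc N0"
  define q where "q = max q0 (1 / 2)"
  have q: "0 < q" "q < 1" using q0 by (auto simp: q_def)
  have step: "prob (surviving R N z) \<le> q" for z
  proof -
    have "prob (surviving R N z) \<le> prob (surviving R N0 z)"
      by (intro finite_measure_mono surviving_antimono) (auto simp: N_def)
    then show ?thesis using q0(2)[of z] by (simp add: q_def)
  qed
  have pow: "prob (surviving R (k * N) z) \<le> q ^ k" for k z
  proof (induction k)
    case (Suc k)
    have "prob (surviving R (k * N + N) z) \<le> prob (surviving R (k * N) z) * q"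
      by (rule prob_surviving_add[OF step])
    also have "\<dots> \<le> q ^ k * q" using Suc q by (intro mult_right_mono) auto
    finally show ?case by (simp add: algebra_simps)
  qed simp
  define l where "l = root N q"
  have l: "0 < l" "l < 1" "l ^ N = q"
    using q by (auto simp: l_def N_def simp del: power_Suc)
  have "prob (surviving R n z) \<le> (1 / q) * l ^ n" for n z
  proof -
    have "prob (surviving R n z) \<le> prob (surviving R (n div N * N) z)"
      by (intro finite_measure_mono surviving_antimono) auto
    also have "\<dots> \<le> q ^ (n div N)" by (rule pow)
    also have "\<dots> = l ^ (n div N * N)"
      by (simp add: l(3)[symmetric] power_mult[symmetric] mult.commute)
    also have "\<dots> \<le> (1 / q) * l ^ n"
    proof -
      have "l ^ (n div N * N) * q = l ^ (n div N * N + N)"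
        by (simp add: l(3) power_add)
      also have "\<dots> \<le> l ^ n"
      proof (rule power_decreasing)
        have "n mod N < N" by (simp add: N_def)
        then show "n \<le> n div N * N + N" using div_mult_mod_eq[of n N] by linarith
      qed (use l in auto)
      finally show ?thesis using q by (simp add: field_simps)
    qed
    finally show ?thesis .
  qed
  then show ?thesis using l by blast
qed

text \<open>By a geometric series, the probability that some critical point born more than
  \<open>N\<close> steps before time \<open>n\<close> survives until \<open>n\<close> is at most a
  constant times \<open>l ^ N\<close>. The bound is uniform in \<open>n\<close> rather than summable
  over \<open>n\<close>, so it yields infinitely many good times instead of all large ones.\<close>

lemma AE_critical_points_escape:
  assumes l: "0 < l" "l < 1" and B: "\<And>n z. prob (surviving R n z) \<le> B * l ^ n"
  shows "AE \<omega> in S. \<exists>N. \<exists>\<^sub>\<infinity>n. \<forall>k. k + N < n \<longrightarrow> (\<lambda>j. \<omega> (k + j)) \<notin> surviving R (n - k) 0"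
proof -
  have "0 \<le> B" using order_trans[OF measure_nonneg B[of 0 0]] by simp
  define A where "A N n = (\<Union>k<n - N. {\<omega>. (\<lambda>j. \<omega> (k + j)) \<in> surviving R (n - k) 0})" for N n
  have A [measurable]: "A N n \<in> sets S" for N n
    unfolding A_def by (intro sets.finite_UN) (auto intro: prob_shift(1))
  have A_le: "prob (A N n) \<le> B / (1 - l) * l ^ N" for N n
  proof (cases "N \<le> n")
    case True
    have "prob (A N n) \<le> (\<Sum>k<n - N. prob {\<omega>. (\<lambda>j. \<omega> (k + j)) \<in> surviving R (n - k) 0})"
      unfolding A_def by (intro finite_measure_subadditive_finite) (auto intro: prob_shift(1))
    also have "\<dots> \<le> (\<Sum>k<n - N. B * l ^ N * l ^ (n - N - k))"
    proof (rule sum_mono)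
      fix k assume k: "k \<in> {..<n - N}"
      have "prob {\<omega>. (\<lambda>j. \<omega> (k + j)) \<in> surviving R (n - k) 0} \<le> B * l ^ (n - k)"
        using B by (simp add: prob_shift(2))
      also have "l ^ (n - k) = l ^ N * l ^ (n - N - k)"
        using k by (auto simp flip: power_add)
      finally show "prob {\<omega>. (\<lambda>j. \<omega> (k + j)) \<in> surviving R (n - k) 0}
          \<le> B * l ^ N * l ^ (n - N - k)"
        by (simp only: mult.assoc)
    qed
    also have "\<dots> = B * l ^ N * (\<Sum>k<n - N. l ^ (n - N - k))"
      by (simp add: sum_distrib_left)
    also have "\<dots> \<le> B * l ^ N * (1 / (1 - l))"
      using l \<open>0 \<le> B\<close> by (intro mult_left_mono sum_geometric_reversed_le) auto
    finally show ?thesis by simp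
  next
    case False
    then show ?thesis using l \<open>0 \<le> B\<close> by (simp add: A_def)
  qed
  \<comment> \<open>Fatou: the event that \<open>A N n\<close> holds for all large \<open>n\<close> is no likelier than the uniform
    bound on \<open>A N n\<close>, and that bound vanishes as \<open>N\<close> grows.\<close>
  define L where "L N m = (\<Inter>n\<in>{m..}. A N n)" for N m
  have L [measurable]: "L N m \<in> sets S" for N m
    unfolding L_def by measurable
  have L_le: "prob (\<Union>m. L N m) \<le> B / (1 - l) * l ^ N" for N
  proof (rule LIMSEQ_le_const2)
    show "(\<lambda>m. prob (L N m)) \<longlonglongrightarrow> prob (\<Union>m. L N m)"
      by (rule finite_Lim_measure_incseq) (auto simp: incseq_def L_def)
    have "prob (L N m) \<le> prob (A N m)" for m
      by (intro finite_measure_mono) (auto simp: L_def)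
    then show "\<exists>M. \<forall>m\<ge>M. prob (L N m) \<le> B / (1 - l) * l ^ N"
      using A_le order_trans by blast
  qed
  have "AE \<omega> in S. \<omega> \<notin> (\<Inter>N. \<Union>m. L N m)"
  proof (rule AE_not_mem_if_prob_le_null_seq)
    show "prob (\<Inter>N. \<Union>m. L N m) \<le> B / (1 - l) * l ^ N" for N
      by (rule order_trans[OF finite_measure_mono L_le[of N]]) auto
    show "(\<lambda>N. B / (1 - l) * l ^ N) \<longlonglongrightarrow> 0"
      using l by (intro tendsto_mult_right_zero LIMSEQ_realpow_zero) auto
  qed measurable
  then show ?thesis
  proof eventually_elim
    case (elim \<omega>)
    then have "\<exists>N. \<forall>m. \<exists>n\<in>{m..}. \<omega> \<notin> A N n" by (simp add: L_def)
    then obtain N where N: "\<And>m. \<exists>n\<ge>m. \<omega> \<notin> A N n" by (auto simp: Bex_def)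
    have "\<exists>\<^sub>\<infinity>n. \<omega> \<notin> A N n"
      unfolding INFM_nat_le using N by blast
    then show ?case
      by (intro exI[of _ N]) (auto simp: A_def elim!: frequently_elim1)
  qed
qed

text \<open>Each point survives forever with probability below every \<open>B * l ^ n\<close>, hence
  0, and countably many null events may be discarded together.\<close>

lemma AE_dense_points_escape:
  assumes l: "0 < l" "l < 1" and B: "\<And>n z. prob (surviving R n z) \<le> B * l ^ n"
    and "countable D"
  shows "AE \<omega> in S. \<forall>d\<in>D. \<exists>n. \<omega> \<notin> surviving R n d"
proof (rule AE_ball_countable'[OF _ assms(4)])
  fix d
  have "AE \<omega> in S. \<omega> \<notin> (\<Inter>n. surviving R n d)"
  proof (rule AE_not_mem_if_prob_le_null_seq)
    show "prob (\<Inter>n. surviving R n d) \<le> B * l ^ n" for n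
      by (rule order_trans[OF finite_measure_mono B[of n d]]) auto
    show "(\<lambda>n. B * l ^ n) \<longlonglongrightarrow> 0"
      using l by (intro tendsto_mult_right_zero LIMSEQ_realpow_zero) auto
  qed measurable
  then show "AE \<omega> in S. \<exists>n. \<omega> \<notin> surviving R n d" by simp
qed

end

section \<open>Total disconnectedness\<close>

text \<open>Compactness gives the closed ball a uniform margin inside \<open>U\<close>. This gains a
  radius strictly beyond \<open>r_bif c\<close>, where no planar minimal set is left.\<close>

lemma cball_subset_open_enlarge:
  fixes c :: "'a::euclidean_space"
  assumes "0 \<le> r" "cball c r \<subseteq> U" "open U"
  obtains s where "r < s" "cball c s \<subseteq> U"
proof -
  obtain \<epsilon> where \<epsilon>: "0 < \<epsilon>" "(\<Union>x\<in>cball c r. ball x \<epsilon>) \<subseteq> U"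
    using compact_subset_open_imp_ball_epsilon_subset[OF compact_cball assms(3,2)] by blast
  have "y \<in> U" if y: "y \<in> cball c (r + \<epsilon> / 2)" for y
  proof (cases "y \<in> cball c r")
    case True
    then show ?thesis using assms(2) by blast
  next
    case False
    define d where "d = norm (y - c)"
    have d: "r < d" "d \<le> r + \<epsilon> / 2" "0 < d"
      using False y assms(1) by (auto simp: d_def dist_norm norm_minus_commute)
    \<comment> \<open>The radial projection of \<open>y\<close> onto the sphere of radius
      \<open>r\<close>.\<close>
    define x where "x = c + (r / d) *\<^sub>R (y - c)"
    have "dist c x = r"
      using d assms(1) by (simp add: x_def dist_norm d_def[symmetric])
    moreover have "y - x = (1 - r / d) *\<^sub>R (y - c)"
      by (simp add: x_def algebra_simps)
    then have "dist x y = \<bar>1 - r / d\<bar> * d"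
      by (simp add: dist_commute[of x y] dist_norm[of y x] d_def[symmetric])
    moreover have "\<bar>1 - r / d\<bar> * d = d - r"
      using d by (simp add: abs_if left_diff_distrib)
    ultimately have "y \<in> ball x \<epsilon>" "x \<in> cball c r"
      using d \<epsilon>(1) by auto
    then show ?thesis using \<epsilon>(2) by blast
  qed
  then show ?thesis using \<epsilon>(1) by (intro that[of "r + \<epsilon> / 2"]) auto
qed

theorem theorem5p1:
  fixes \<mu> :: "complex measure"
  assumes "prob_space \<mu>"
    and "sets \<mu> = sets borel"
    and "compact (msupp \<mu>)"
  shows "((\<exists>c. msupp \<mu> \<subseteq> cball c (r_bif c)) \<longrightarrow>
            has_planar_minimal_set (poly_semigroup (msupp \<mu>)))
       \<and> ((\<exists>c. cball c (r_bif c) \<subseteq> interior (msupp \<mu>)) \<longrightarrow>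
            (AE \<omega> in (\<Pi>\<^sub>M n\<in>(UNIV :: nat set). \<mu>).
               (\<forall>n. \<omega> n \<in> msupp \<mu>) \<longrightarrow> totally_disconnected (random_julia \<omega>)))"
proof (intro conjI impI)
  assume "\<exists>c. msupp \<mu> \<subseteq> cball c (r_bif c)"
  then show "has_planar_minimal_set (poly_semigroup (msupp \<mu>))"
    using has_planar_minimal_set_cball_r_bif has_planar_minimal_set_mono by blast
next
  assume "\<exists>c. cball c (r_bif c) \<subseteq> interior (msupp \<mu>)"
  then obtain c where c: "cball c (r_bif c) \<subseteq> interior (msupp \<mu>)" by blast
  interpret prob_space \<mu> by (rule assms(1))
  interpret random_quadratic \<mu>
    by unfold_locales (rule assms(2))
  obtain \<rho> where \<rho>: "\<And>z. z \<in> msupp \<mu> \<Longrightarrow> cmod z \<le> \<rho>"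
    using assms(3) compact_imp_bounded bounded_iff by metis
  obtain r where r: "r_bif c < r" "cball c r \<subseteq> interior (msupp \<mu>)"
    by (rule cball_subset_open_enlarge[OF r_bif_nonneg c open_interior])
  \<comment> \<open>A nonempty core would give a planar minimal set for the support, hence for its
    subset \<open>cball c r\<close>, although \<open>r\<close> exceeds
    \<open>r_bif c\<close>.\<close>
  have "invariant_core (msupp \<mu>) (\<rho> + 5) = {}"
  proof (rule ccontr)
    assume "invariant_core (msupp \<mu>) (\<rho> + 5) \<noteq> {}"
    then have "has_planar_minimal_set (poly_semigroup (cball c r))"
      by (rule has_planar_minimal_set_mono[OF has_planar_minimal_set_if_invariant_core])
        (rule order_trans[OF r(2) interior_subset])
    then show False using le_r_bif[of r c] r_bif_nonneg[of c] r(1) by simp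
  qed
  then have "\<exists>w n. (\<forall>i<n. w i \<in> msupp \<mu>) \<and> \<rho> + 5 < cmod (iter_seq w n z)" for z
    unfolding invariant_core_def by (auto simp: not_le)
  from prob_surviving_geometric[OF this] obtain B l where l: "0 < l" "l < 1"
    and B: "\<And>n z. P.prob (surviving (\<rho> + 5) n z) \<le> B * l ^ n"
    by blast
  obtain D :: "complex set" where D: "countable D" "\<And>U. open U \<Longrightarrow> U \<noteq> {} \<Longrightarrow> \<exists>d\<in>D. d \<in> U"
    using countable_dense_setE by metis
  show "AE \<omega> in S. (\<forall>n. \<omega> n \<in> msupp \<mu>) \<longrightarrow> totally_disconnected (random_julia \<omega>)"
    using AE_critical_points_escape[OF l B] AE_dense_points_escape[OF l B D(1)]
  proof eventually_elim
    case (elim \<omega>)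
    show ?case
    proof
      assume \<omega>: "\<forall>n. \<omega> n \<in> msupp \<mu>"
      have bnd: "cmod (\<omega> i) \<le> \<rho>" for i using \<omega> \<rho> by blast
      obtain N where N: "\<exists>\<^sub>\<infinity>n. \<forall>k. k + N < n \<longrightarrow>
          (\<lambda>j. \<omega> (k + j)) \<notin> surviving (\<rho> + 5) (n - k) 0"
        using elim(1) by blast
      have "\<exists>a. C \<subseteq> {a}" if C: "C \<subseteq> random_julia \<omega>" "connected C" for C
      proof (rule connected_bounded_orbit_subset_singleton[OF bnd _ _ C(2)])
        fix U :: "complex set" assume "open U" "U \<noteq> {}"
        then obtain d where "d \<in> D" "d \<in> U" using D(2) by blast
        then show "\<exists>d\<in>U. \<exists>n. \<rho> + 5 < cmod (iter_seq \<omega> n d)"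
          using elim(2) by (force simp: surviving_def not_le)
      next
        show "\<exists>\<^sub>\<infinity>n. \<forall>k. k + N < n \<longrightarrow>
            (\<exists>i\<le>n - k. \<rho> + 5 < cmod (iter_seq (\<lambda>j. \<omega> (k + j)) i 0))"
          using N by (simp add: surviving_def not_le)
      next
        fix z n assume "z \<in> C"
        then show "cmod (iter_seq \<omega> n z) \<le> \<rho> + 2"
          using C(1) by (intro random_julia_bounded_orbit bnd) blast
      qed
      then show "totally_disconnected (random_julia \<omega>)"
        unfolding totally_disconnected_def by blast
    qed
  qed
qed

end
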